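(* Let $G$ be a finitely-generated, discrete group, and let $\omega$ be a weight on $G$. (i) If $\omega$ is either a radial polynomial weight, or a radial exponential weight of degree strictly less than $1$, then $\ell^{1}_{0}(G,\omega)$ is finitely-generated as a left ideal of $\ell^1(G,\omega)$ only if $G$ is finite. (ii) If $\omega$ is a radial exponential weight of degree equal to $1$, then $\ell^{1}_{0}(G,\omega)$ is finitely-generated as a left ideal of $\ell^1(G,\omega)$.
   Context: A weight on a group $G$ with identity $e$ is a function $\omega:G\to[1,\infty)$ with $\omega(uv)\le\omega(u)\omega(v)$ for all $u,v\in G$ and $\omega(e)=1$. Fix a finite generating set $X$ of $G$ and let $|u|_X$ be the word-length of $u\in G$ with respect to $X$ (the least number of factors from $X\cup X^{-1}$ needed to express $u$). A radial polynomial weight of degree $\alpha$, where $\alpha\ge0$, is a weight of the form $\omega(u)=(1+|u|_X)^\alpha$. A radial exponential weight with base $c$ and degree $\beta$, where $c\ge1$ and $0<\beta\le1$, is a weight of the form $\omega(u)=c^{|u|_X^\beta}$. $\ell^1(G,\omega)$ is the set of $f:G\to\mathbb{C}$ with $\|f\|_\omega=\sum_{u\in G}|f(u)|\omega(u)<\infty$, a unital Banach algebra under convolution. The augmentation ideal is $\ell^1_0(G,\omega)=\{f\in\ell^1(G,\omega):\sum_{u\in G}f(u)=0\}$. A left ideal $I$ of a unital algebra $A$ is finitely-generated if there exist $n\in\mathbb{N}$ and $x_1,\ldots,x_n\in A$ with $I=Ax_1+\cdots+Ax_n$ (purely algebraically, no closure is taken).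
   Formalization: In part (ii) the base is required to satisfy c > 1: for c = 1 the weight is constantly 1, which is also the radial polynomial weight of degree 0, so by part (i) the claim would fail for every infinite finitely-generated group, such as the integers. *)

theory Defs
  imports "HOL-Algebra.Generated_Groups" "HOL-Algebra.Ring" "HOL-Analysis.Analysis"
begin

definition weight :: "('a, 'b) monoid_scheme \<Rightarrow> ('a \<Rightarrow> real) \<Rightarrow> bool" where
  "weight G \<omega> \<longleftrightarrow>
     (\<forall>u\<in>carrier G. 1 \<le> \<omega> u) \<and>
     (\<forall>u\<in>carrier G. \<forall>v\<in>carrier G. \<omega> (u \<otimes>\<^bsub>G\<^esub> v) \<le> \<omega> u * \<omega> v) \<and>
     \<omega> \<one>\<^bsub>G\<^esub> = 1"

text \<open>Only meaningful when \<open>u\<close> lies in the subgroup generated by \<open>X\<close>; the empty word has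
  product \<open>\<one>\<close>, so the identity has length \<open>0\<close>.\<close>

definition word_length :: "('a, 'b) monoid_scheme \<Rightarrow> 'a set \<Rightarrow> 'a \<Rightarrow> nat" where
  "word_length G X u =
     (LEAST n. \<exists>xs. length xs = n \<and> set xs \<subseteq> X \<union> (\<lambda>x. inv\<^bsub>G\<^esub> x) ` X \<and>
        foldr (\<lambda>x y. x \<otimes>\<^bsub>G\<^esub> y) xs \<one>\<^bsub>G\<^esub> = u)"

definition radial_polynomial_weight ::
    "('a, 'b) monoid_scheme \<Rightarrow> 'a set \<Rightarrow> real \<Rightarrow> ('a \<Rightarrow> real) \<Rightarrow> bool" where
  "radial_polynomial_weight G X \<alpha> \<omega> \<longleftrightarrow>
     weight G \<omega> \<and> 0 \<le> \<alpha> \<and>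
     (\<forall>u\<in>carrier G. \<omega> u = (1 + real (word_length G X u)) powr \<alpha>)"

text \<open>The base \<open>c = 1\<close> is allowed here and gives the constant weight \<open>1\<close>, for every degree
  \<open>\<beta>\<close>; this is also the radial polynomial weight of degree \<open>0\<close>. Results that
  distinguish degree \<open>1\<close> from smaller degrees therefore need \<open>c > 1\<close>.\<close>

definition radial_exponential_weight ::
    "('a, 'b) monoid_scheme \<Rightarrow> 'a set \<Rightarrow> real \<Rightarrow> real \<Rightarrow> ('a \<Rightarrow> real) \<Rightarrow> bool" where
  "radial_exponential_weight G X c \<beta> \<omega> \<longleftrightarrow>
     weight G \<omega> \<and> 1 \<le> c \<and> 0 < \<beta> \<and> \<beta> \<le> 1 \<and>
     (\<forall>u\<in>carrier G. \<omega> u = c powr (real (word_length G X u) powr \<beta>))"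

text \<open>A function on the group is represented by its extension by \<open>0\<close> outside the carrier,
  so that each such function has exactly one representative.\<close>

definition l1_space :: "('a, 'b) monoid_scheme \<Rightarrow> ('a \<Rightarrow> real) \<Rightarrow> ('a \<Rightarrow> complex) set" where
  "l1_space G \<omega> =
     {f. (\<forall>u. u \<notin> carrier G \<longrightarrow> f u = 0) \<and>
         (\<lambda>u. norm (f u) * \<omega> u) summable_on carrier G}"

definition convolution ::
    "('a, 'b) monoid_scheme \<Rightarrow> ('a \<Rightarrow> complex) \<Rightarrow> ('a \<Rightarrow> complex) \<Rightarrow> 'a \<Rightarrow> complex" where
  "convolution G f g =
     (\<lambda>u. if u \<in> carrier G
          then (\<Sum>\<^sub>\<infinity>v\<in>carrier G. f v * g (inv\<^bsub>G\<^esub> v \<otimes>\<^bsub>G\<^esub> u)) else 0)"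

definition l1_algebra :: "('a, 'b) monoid_scheme \<Rightarrow> ('a \<Rightarrow> real) \<Rightarrow> ('a \<Rightarrow> complex) ring" where
  "l1_algebra G \<omega> =
     \<lparr>carrier = l1_space G \<omega>,
      monoid.mult = convolution G,
      one = (\<lambda>u. if u = \<one>\<^bsub>G\<^esub> then 1 else 0),
      zero = (\<lambda>u. 0),
      add = (\<lambda>f g u. f u + g u)\<rparr>"

definition augmentation_ideal ::
    "('a, 'b) monoid_scheme \<Rightarrow> ('a \<Rightarrow> real) \<Rightarrow> ('a \<Rightarrow> complex) set" where
  "augmentation_ideal G \<omega> = {f \<in> carrier (l1_algebra G \<omega>). (\<Sum>\<^sub>\<infinity>u\<in>carrier G. f u) = 0}"

text \<open>\<open>I = A x\<^sub>0 + \<dots> + A x\<^bsub>n-1\<^esub>\<close> for the ring \<open>A = R\<close>; such a set is automatically a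
  left ideal.\<close>

definition finitely_generated_left_ideal :: "('a, 'b) ring_scheme \<Rightarrow> 'a set \<Rightarrow> bool" where
  "finitely_generated_left_ideal R I \<longleftrightarrow>
     (\<exists>n::nat. \<exists>x. x \<in> {..<n} \<rightarrow> carrier R \<and>
        I = {\<Oplus>\<^bsub>R\<^esub>i\<in>{..<n}. a i \<otimes>\<^bsub>R\<^esub> x i | a. a \<in> {..<n} \<rightarrow> carrier R})"

end

theory Submission
  imports Defs "HOL-Real_Asymp.Real_Asymp"
begin

text \<open>
  For a radial weight \<open>\<omega> u = W \<bar>u\<bar>\<close> everything depends on how \<open>W n\<close> compares with the sum
  \<open>\<Phi> n = W 0 + \<dots> + W (n - 1)\<close>, the cost of a geodesic path from the identity to level \<open>n\<close>.

  If \<open>\<Phi> n \<le> C * W n\<close>, as for \<open>W n = c ^ n\<close> with \<open>c > 1\<close>, then \<open>\<delta>\<^sub>u - \<delta>\<^sub>\<one>\<close> telescopes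
  along a geodesic into left multiples of the elements \<open>\<delta>\<^sub>y - \<delta>\<^sub>\<one>\<close>, where \<open>y\<close> is a generator or
  an inverse of one, with coefficients of norm at most \<open>C * \<omega> u\<close> (\<open>path_kernel\<close>). Summing over
  \<open>u\<close> shows that these finitely many elements generate the augmentation ideal
  (\<open>augmentation_ideal_finitely_generated\<close>).

  If \<open>W\<close> is nondecreasing and \<open>W n / W (n + 1)\<close> tends to \<open>1\<close>, as for polynomial weights and
  exponential weights of degree below \<open>1\<close>, then \<open>\<Phi> n / W n\<close> is unbounded
  (\<open>partial_sums_outgrow\<close>). Take \<open>\<phi> v = \<Phi> \<bar>v\<bar>\<close>, cut off at the first level where
  \<open>\<Phi> \<ge> s * W\<close>. If the group is infinite, this functional has norm about \<open>s\<close> while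
  \<open>\<bar>\<phi> (v \<otimes> w) - \<phi> v\<bar> \<le> \<omega> v * \<omega> w * min \<bar>w\<bar> (s + 1)\<close> (\<open>steep_test_functional\<close>). A generator
  \<open>h\<close> has sum \<open>0\<close>, so on a left multiple \<open>g * h\<close> the value of \<open>\<phi>\<close> only involves increments
  and is at most the norm of \<open>g\<close> times the truncated moment
  \<open>\<Sum>\<^sub>w \<bar>h w\<bar> * \<omega> w * min \<bar>w\<bar> (s + 1)\<close> (\<open>functional_on_left_multiple\<close>). By dominated convergence
  this moment is \<open>o(s)\<close> (\<open>truncated_moment_small\<close>). Functionals of norm about \<open>s\<close>
  that are \<open>o(s)\<close> at every element of the ideal contradict uniform boundedness. As the functionals
  are nonnegative, the contradiction shows at one explicit element (\<open>positive_test_element\<close>).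
\<close>

text \<open>Two constants share this notation; it is kept for absolute summability in the sense of
  unordered sums.\<close>

no_notation Infinite_Set_Sum.abs_summable_on (infix \<open>abs'_summable'_on\<close> 50)

section \<open>Word length\<close>

locale marked_group = group G for G (structure) +
  fixes X
  assumes gens_closed: "X \<subseteq> carrier G" and gens_generate: "generate G X = carrier G"
begin

definition letters where "letters = X \<union> (\<lambda>x. inv x) ` X"

abbreviation word_prod where "word_prod xs \<equiv> foldr (\<lambda>x y. x \<otimes> y) xs \<one>"

abbreviation len where "len u \<equiv> word_length G X u"

lemma letters_closed: "y \<in> letters \<Longrightarrow> y \<in> carrier G"
  using gens_closed by (auto simp: letters_def)

lemma letters_inv: "y \<in> letters \<Longrightarrow> inv y \<in> letters"
  using gens_closed by (auto simp: letters_def)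

lemma word_prod_closed: "set xs \<subseteq> letters \<Longrightarrow> word_prod xs \<in> carrier G"
  by (induction xs) (auto simp: letters_closed)

lemma word_prod_append:
  "set xs \<subseteq> letters \<Longrightarrow> set ys \<subseteq> letters \<Longrightarrow> word_prod (xs @ ys) = word_prod xs \<otimes> word_prod ys"
proof (induction xs)
  case Nil
  then show ?case by (simp add: word_prod_closed)
next
  case (Cons x xs)
  then have "x \<in> carrier G" "word_prod xs \<in> carrier G" "word_prod ys \<in> carrier G"
    by (auto simp: letters_closed word_prod_closed)
  then show ?case using Cons by (simp add: m_assoc)
qed

lemma word_prod_inv:
  "set xs \<subseteq> letters \<Longrightarrow> word_prod (rev (map (\<lambda>x. inv x) xs)) = inv (word_prod xs)"
proof (induction xs)
  case (Cons x xs)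
  have sub: "set (rev (map (\<lambda>x. inv x) xs)) \<subseteq> letters" "set [inv x] \<subseteq> letters"
    using Cons.prems letters_inv by auto
  have cl: "x \<in> carrier G" "word_prod xs \<in> carrier G"
    using Cons.prems by (auto simp: letters_closed word_prod_closed)
  have "word_prod (rev (map (\<lambda>x. inv x) (x # xs)))
      = word_prod (rev (map (\<lambda>x. inv x) xs) @ [inv x])"
    by simp
  also have "\<dots> = word_prod (rev (map (\<lambda>x. inv x) xs)) \<otimes> word_prod [inv x]"
    by (rule word_prod_append[OF sub])
  also have "\<dots> = inv (word_prod xs) \<otimes> inv x" using Cons cl by simp
  finally show ?case using cl by (simp add: inv_mult_group)
qed simp

lemma word_exists:
  assumes "u \<in> carrier G"
  shows "\<exists>xs. set xs \<subseteq> letters \<and> word_prod xs = u"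
proof -
  have "u \<in> generate G X" using assms gens_generate by simp
  then show ?thesis
  proof induction
    case one
    show ?case by (intro exI[of _ "[]"]) simp
  next
    case (incl h)
    then have "h \<in> letters" by (simp add: letters_def)
    then show ?case using letters_closed by (intro exI[of _ "[h]"]) simp
  next
    case (inv h)
    then have "inv h \<in> letters" by (simp add: letters_def)
    then show ?case using letters_closed by (intro exI[of _ "[inv h]"]) simp
  next
    case (eng h1 h2)
    then obtain xs ys where "set xs \<subseteq> letters" "word_prod xs = h1"
      "set ys \<subseteq> letters" "word_prod ys = h2" by blast
    then show ?case using word_prod_append[of xs ys] by (intro exI[of _ "xs @ ys"]) simp
  qed
qed

lemma geodesic_word:
  assumes "u \<in> carrier G"
  obtains xs where "length xs = len u" "set xs \<subseteq> letters" "word_prod xs = u"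
proof -
  let ?P = "\<lambda>n. \<exists>xs. length xs = n \<and> set xs \<subseteq> letters \<and> word_prod xs = u"
  have "\<exists>n. ?P n" using word_exists[OF assms] by blast
  then have "?P (LEAST n. ?P n)" by (rule LeastI_ex)
  then show thesis using that unfolding word_length_def letters_def by blast
qed

lemma len_word_prod_le: "set xs \<subseteq> letters \<Longrightarrow> len (word_prod xs) \<le> length xs"
  unfolding word_length_def letters_def by (rule Least_le) blast

lemma len_one [simp]: "len \<one> = 0"
  using len_word_prod_le[of "[]"] by simp

lemma len_mult_le:
  assumes "u \<in> carrier G" "v \<in> carrier G"
  shows "len (u \<otimes> v) \<le> len u + len v"
proof -
  obtain xs where xs: "length xs = len u" "set xs \<subseteq> letters" "word_prod xs = u"
    using geodesic_word[OF assms(1)] .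
  obtain ys where ys: "length ys = len v" "set ys \<subseteq> letters" "word_prod ys = v"
    using geodesic_word[OF assms(2)] .
  show ?thesis using xs ys word_prod_append[of xs ys] len_word_prod_le[of "xs @ ys"] by simp
qed

lemma len_inv_le: "u \<in> carrier G \<Longrightarrow> len (inv u) \<le> len u"
proof -
  assume "u \<in> carrier G"
  then obtain xs where xs: "length xs = len u" "set xs \<subseteq> letters" "word_prod xs = u"
    by (rule geodesic_word)
  have "set (rev (map (\<lambda>x. inv x) xs)) \<subseteq> letters" using xs letters_inv by auto
  from len_word_prod_le[OF this] show ?thesis using xs word_prod_inv[of xs] by simp
qed

lemma len_le_mult:
  assumes "v \<in> carrier G" "w \<in> carrier G"
  shows "len v \<le> len (v \<otimes> w) + len w"
proof -
  have "v = (v \<otimes> w) \<otimes> inv w" using assms by (simp add: m_assoc)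
  then have "len v \<le> len (v \<otimes> w) + len (inv w)" using len_mult_le[of "v \<otimes> w" "inv w"] assms by simp
  then show ?thesis using len_inv_le[OF assms(2)] by simp
qed

lemma len_0_iff: "u \<in> carrier G \<Longrightarrow> len u = 0 \<longleftrightarrow> u = \<one>"
  by (rule geodesic_word[of u]) auto

text \<open>Removing the last letter of a geodesic word leaves a geodesic word: otherwise a shorter word
  for the prefix would give a shorter word for \<open>u\<close>.\<close>

lemma len_Suc_split:
  assumes "u \<in> carrier G" "len u = Suc n"
  obtains u' y where "u' \<in> carrier G" "len u' = n" "y \<in> letters" "u = u' \<otimes> y"
proof -
  obtain xs where xs: "length xs = len u" "set xs \<subseteq> letters" "word_prod xs = u"
    using geodesic_word[OF assms(1)] .
  then obtain ys y where ys: "xs = ys @ [y]" using assms(2) by (cases xs rule: rev_cases) auto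
  have y: "y \<in> letters" "y \<in> carrier G" using xs ys letters_closed by auto
  have c: "word_prod ys \<in> carrier G" using xs ys word_prod_closed by auto
  have u: "u = word_prod ys \<otimes> y" using word_prod_append[of ys "[y]"] xs ys y by simp
  have "len (word_prod ys) \<le> n" using len_word_prod_le[of ys] xs ys assms by auto
  moreover have "len y \<le> 1" using len_word_prod_le[of "[y]"] y by simp
  then have "Suc n \<le> len (word_prod ys) + 1"
    using len_mult_le[OF c y(2)] u assms by simp
  ultimately show thesis using that c y u by simp
qed

text \<open>A missing sphere would cut off all larger ones and leave a finite ball.\<close>

lemma sphere_nonempty:
  assumes "finite X" "infinite (carrier G)"
  shows "\<exists>u\<in>carrier G. len u = n"
proof (rule ccontr)
  assume no: "\<not> ?thesis"
  have "\<not> (\<exists>u\<in>carrier G. len u = n + k)" for k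
  proof (induction k)
    case (Suc k)
    show ?case
    proof
      assume "\<exists>u\<in>carrier G. len u = n + Suc k"
      then obtain u where u: "u \<in> carrier G" "len u = Suc (n + k)" by auto
      then obtain u' where "u' \<in> carrier G" "len u' = n + k" by (rule len_Suc_split)
      then show False using Suc by blast
    qed
  qed (use no in simp)
  then have short: "len u < n" if "u \<in> carrier G" for u
    using that by (metis le_add_diff_inverse not_le)
  have "finite letters" using assms(1) by (simp add: letters_def)
  then have "finite (word_prod ` {xs. set xs \<subseteq> letters \<and> length xs \<le> n})"
    by (intro finite_imageI finite_lists_length_le)
  moreover have "carrier G \<subseteq> word_prod ` {xs. set xs \<subseteq> letters \<and> length xs \<le> n}"
  proof
    fix u assume u: "u \<in> carrier G"
    obtain xs where "length xs = len u" "set xs \<subseteq> letters" "word_prod xs = u"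
      using geodesic_word[OF u] .
    then show "u \<in> word_prod ` {xs. set xs \<subseteq> letters \<and> length xs \<le> n}"
      using short[OF u] by (intro image_eqI[of _ _ xs]) auto
  qed
  ultimately show False using assms(2) finite_subset by blast
qed

end

section \<open>The weighted group algebra and its augmentation ideal\<close>

locale weighted_group = group G for G (structure) +
  fixes \<omega> :: "'a \<Rightarrow> real"
  assumes weight: "weight G \<omega>"
begin

lemma weight_ge_1: "u \<in> carrier G \<Longrightarrow> 1 \<le> \<omega> u"
  and weight_mult_le: "u \<in> carrier G \<Longrightarrow> v \<in> carrier G \<Longrightarrow> \<omega> (u \<otimes> v) \<le> \<omega> u * \<omega> v"
  using weight by (auto simp: weight_def)

lemma l1_vanish: "f \<in> l1_space G \<omega> \<Longrightarrow> u \<notin> carrier G \<Longrightarrow> f u = 0"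
  and l1_summable: "f \<in> l1_space G \<omega> \<Longrightarrow> (\<lambda>u. norm (f u) * \<omega> u) summable_on carrier G"
  by (auto simp: l1_space_def)

lemma l1_pairing_summable:
  fixes \<phi> :: "'a \<Rightarrow> complex"
  assumes f: "f \<in> l1_space G \<omega>" and \<phi>: "\<And>u. u \<in> carrier G \<Longrightarrow> norm (\<phi> u) \<le> C * \<omega> u"
  shows "(\<lambda>u. f u * \<phi> u) abs_summable_on carrier G"
proof (rule Infinite_Sum.abs_summable_on_comparison_test')
  show "(\<lambda>u. norm (f u) * \<omega> u * C) summable_on carrier G"
    by (intro summable_on_cmult_left l1_summable f)
  show "norm (f u * \<phi> u) \<le> norm (f u) * \<omega> u * C" if "u \<in> carrier G" for u
    using mult_left_mono[OF \<phi>[OF that] norm_ge_zero[of "f u"]] by (simp add: norm_mult ac_simps)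
qed

lemma l1_abs_summable:
  assumes "f \<in> l1_space G \<omega>"
  shows "f abs_summable_on carrier G"
  using l1_pairing_summable[OF assms, of "\<lambda>_. 1" 1] weight_ge_1 by simp

lemma l1_domination:
  assumes f: "f \<in> l1_space G \<omega>" and "\<And>u. u \<notin> carrier G \<Longrightarrow> g u = 0"
    and "\<And>u. u \<in> carrier G \<Longrightarrow> norm (g u) \<le> norm (f u)"
  shows "g \<in> l1_space G \<omega>"
proof -
  have "(\<lambda>u. norm (g u) * \<omega> u) summable_on carrier G"
  proof (rule summable_on_comparison_test[OF l1_summable[OF f]])
    fix u assume u: "u \<in> carrier G"
    then have "0 \<le> \<omega> u" using weight_ge_1[OF u] by linarith
    then show "norm (g u) * \<omega> u \<le> norm (f u) * \<omega> u" "0 \<le> norm (g u) * \<omega> u"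
      using assms(3)[OF u] by (auto intro: mult_right_mono)
  qed
  then show ?thesis using assms(2) by (simp add: l1_space_def)
qed

lemma l1_add:
  assumes f: "f \<in> l1_space G \<omega>" and g: "g \<in> l1_space G \<omega>"
  shows "(\<lambda>u. f u + g u) \<in> l1_space G \<omega>"
proof -
  have "(\<lambda>u. norm (f u + g u) * \<omega> u) summable_on carrier G"
  proof (rule summable_on_comparison_test)
    show "(\<lambda>u. norm (f u) * \<omega> u + norm (g u) * \<omega> u) summable_on carrier G"
      by (intro summable_on_add l1_summable f g)
    fix u assume u: "u \<in> carrier G"
    then have "0 \<le> \<omega> u" using weight_ge_1[OF u] by linarith
    then show "norm (f u + g u) * \<omega> u \<le> norm (f u) * \<omega> u + norm (g u) * \<omega> u"
      "0 \<le> norm (f u + g u) * \<omega> u"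
      using mult_right_mono[OF norm_triangle_ineq[of "f u" "g u"]] by (auto simp: distrib_right)
  qed
  then show ?thesis using l1_vanish[OF f] l1_vanish[OF g] by (simp add: l1_space_def)
qed

lemma l1_finite_support:
  assumes "finite S" "S \<subseteq> carrier G" "\<And>u. u \<notin> S \<Longrightarrow> f u = 0"
  shows "f \<in> l1_space G \<omega>"
proof -
  have "{u \<in> carrier G. norm (f u) * \<omega> u \<noteq> 0} \<subseteq> S" using assms(3) by auto
  then have "finite {u \<in> carrier G. norm (f u) * \<omega> u \<noteq> 0}" using assms(1) finite_subset by blast
  then have "(\<lambda>u. norm (f u) * \<omega> u) summable_on carrier G"
    by (rule finite_nonzero_values_imp_summable_on)
  then show ?thesis using assms(2,3) by (auto simp: l1_space_def)
qed

lemma l1_zero: "(\<lambda>u. 0) \<in> l1_space G \<omega>"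
  by (rule l1_finite_support[of "{}"]) auto

text \<open>By submultiplicativity, \<open>\<omega> (v \<otimes> w) \<le> \<omega> v * \<omega> w\<close>, the double series is dominated
  by the product of the norm series of \<open>g\<close> and \<open>h\<close>.\<close>

lemma product_abs_summable:
  fixes \<phi> :: "'a \<Rightarrow> complex"
  assumes g: "g \<in> l1_space G \<omega>" and h: "h \<in> l1_space G \<omega>"
    and \<phi>: "\<And>u. u \<in> carrier G \<Longrightarrow> norm (\<phi> u) \<le> C * \<omega> u"
  shows "(\<lambda>(v, w). g v * h w * \<phi> (v \<otimes> w)) abs_summable_on (carrier G \<times> carrier G)"
proof (rule Infinite_Sum.abs_summable_on_comparison_test')
  let ?N = "\<Sum>\<^sub>\<infinity>w\<in>carrier G. norm (h w) * \<omega> w"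
  have "(\<lambda>(v, w). norm (g v) * \<omega> v * (norm (h w) * \<omega> w)) summable_on (carrier G \<times> carrier G)"
  proof (rule summable_on_SigmaI)
    show "((\<lambda>w. case (v, w) of (v, w) \<Rightarrow> norm (g v) * \<omega> v * (norm (h w) * \<omega> w))
        has_sum norm (g v) * \<omega> v * ?N) (carrier G)" for v
      using has_sum_cmult_right[OF has_sum_infsum[OF l1_summable[OF h]]] by simp
    show "(\<lambda>v. norm (g v) * \<omega> v * ?N) summable_on carrier G"
      by (intro summable_on_cmult_left l1_summable g)
    fix v w assume vw: "v \<in> carrier G" "w \<in> carrier G"
    have "0 \<le> \<omega> v" "0 \<le> \<omega> w" using vw weight_ge_1[of v] weight_ge_1[of w] by linarith+
    then show "(case (v, w) of (v, w) \<Rightarrow> norm (g v) * \<omega> v * (norm (h w) * \<omega> w)) \<ge> 0" by simp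
  qed
  then show "(\<lambda>p. \<bar>C\<bar> * (case p of (v, w) \<Rightarrow> norm (g v) * \<omega> v * (norm (h w) * \<omega> w)))
      summable_on (carrier G \<times> carrier G)"
    by (rule summable_on_cmult_right)
  fix p assume "p \<in> carrier G \<times> carrier G"
  then obtain v w where p: "p = (v, w)" "v \<in> carrier G" "w \<in> carrier G" by auto
  have "norm (\<phi> (v \<otimes> w)) \<le> C * \<omega> (v \<otimes> w)" using \<phi> p by simp
  also have "\<dots> \<le> \<bar>C\<bar> * \<omega> (v \<otimes> w)"
    using weight_ge_1[of "v \<otimes> w"] p by (intro mult_right_mono) auto
  also have "\<dots> \<le> \<bar>C\<bar> * (\<omega> v * \<omega> w)"
    using weight_mult_le p by (intro mult_left_mono) auto
  finally have "norm (g v) * norm (h w) * norm (\<phi> (v \<otimes> w))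
      \<le> norm (g v) * norm (h w) * (\<bar>C\<bar> * (\<omega> v * \<omega> w))"
    by (intro mult_left_mono) auto
  then show "norm (case p of (v, w) \<Rightarrow> g v * h w * \<phi> (v \<otimes> w))
      \<le> \<bar>C\<bar> * (case p of (v, w) \<Rightarrow> norm (g v) * \<omega> v * (norm (h w) * \<omega> w))"
    using p by (simp add: norm_mult ac_simps)
qed

text \<open>The pairing of \<open>g * h\<close> with a functional, by Fubini and the substitution
  \<open>u = v \<otimes> w\<close>. It moves the functional from the product to \<open>h\<close>, translated by \<open>v\<close>; with
  \<open>\<phi> = 1\<close> it says that the augmentation is multiplicative, and with \<open>\<phi> = \<omega>\<close>, applied
  to absolute values, it bounds the norm of a product.\<close>

lemma convolution_pairing:
  fixes \<phi> :: "'a \<Rightarrow> complex"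
  assumes g: "g \<in> l1_space G \<omega>" and h: "h \<in> l1_space G \<omega>"
    and \<phi>: "\<And>u. u \<in> carrier G \<Longrightarrow> norm (\<phi> u) \<le> C * \<omega> u"
  shows "(\<lambda>u. convolution G g h u * \<phi> u) summable_on carrier G"
    and "(\<Sum>\<^sub>\<infinity>u\<in>carrier G. convolution G g h u * \<phi> u)
       = (\<Sum>\<^sub>\<infinity>v\<in>carrier G. g v * (\<Sum>\<^sub>\<infinity>w\<in>carrier G. h w * \<phi> (v \<otimes> w)))"
proof -
  let ?F = "\<lambda>(v, w). g v * h w * \<phi> (v \<otimes> w)"
  let ?E = "\<lambda>u v. g v * h (inv v \<otimes> u) * \<phi> u"
  have F: "?F summable_on carrier G \<times> carrier G"
    by (rule abs_summable_summable[OF product_abs_summable[OF g h \<phi>]])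
  let ?T = "\<lambda>(u, v). (v, inv v \<otimes> u)"
  have bij: "bij_betw ?T (carrier G \<times> carrier G) (carrier G \<times> carrier G)"
    by (rule bij_betwI[where g = "\<lambda>(v, w). (v \<otimes> w, v)"]) (auto simp: m_assoc[symmetric])
  have cong: "?F (?T p) = (case p of (u, v) \<Rightarrow> ?E u v)"
    if "p \<in> carrier G \<times> carrier G" for p
    using that by (auto simp: m_assoc[symmetric])
  have "(\<lambda>p. ?F (?T p)) summable_on carrier G \<times> carrier G"
    using F by (rule summable_on_reindex_bij_betw[OF bij, THEN iffD2])
  moreover have "(\<lambda>p. ?F (?T p)) summable_on carrier G \<times> carrier G
      \<longleftrightarrow> (\<lambda>(u, v). ?E u v) summable_on carrier G \<times> carrier G"
    by (rule summable_on_cong) (rule cong)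
  ultimately have E: "(\<lambda>(u, v). ?E u v) summable_on carrier G \<times> carrier G" by blast
  have row: "(\<Sum>\<^sub>\<infinity>v\<in>carrier G. ?E u v) = convolution G g h u * \<phi> u" if "u \<in> carrier G" for u
    using that by (simp add: convolution_def infsum_cmult_left')
  show "(\<lambda>u. convolution G g h u * \<phi> u) summable_on carrier G"
  proof -
    have "(\<lambda>u. convolution G g h u * \<phi> u) summable_on carrier G
        \<longleftrightarrow> (\<lambda>u. \<Sum>\<^sub>\<infinity>v\<in>carrier G. ?E u v) summable_on carrier G"
      by (rule summable_on_cong) (rule row[symmetric])
    then show ?thesis using summable_on_Sigma_banach[OF E] by blast
  qed
  have "(\<Sum>\<^sub>\<infinity>u\<in>carrier G. convolution G g h u * \<phi> u) = (\<Sum>\<^sub>\<infinity>u\<in>carrier G. \<Sum>\<^sub>\<infinity>v\<in>carrier G. ?E u v)"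
    by (rule infsum_cong) (simp add: row)
  also have "\<dots> = (\<Sum>\<^sub>\<infinity>(u, v)\<in>carrier G \<times> carrier G. ?E u v)" by (rule infsum_Sigma'_banach[OF E])
  also have "\<dots> = (\<Sum>\<^sub>\<infinity>p\<in>carrier G \<times> carrier G. ?F (?T p))"
    by (rule infsum_cong) (rule cong[symmetric])
  also have "\<dots> = infsum ?F (carrier G \<times> carrier G)" by (rule infsum_reindex_bij_betw[OF bij])
  also have "\<dots> = (\<Sum>\<^sub>\<infinity>v\<in>carrier G. \<Sum>\<^sub>\<infinity>w\<in>carrier G. g v * h w * \<phi> (v \<otimes> w))"
    by (rule infsum_Sigma'_banach[OF F, symmetric])
  also have "\<dots> = (\<Sum>\<^sub>\<infinity>v\<in>carrier G. g v * (\<Sum>\<^sub>\<infinity>w\<in>carrier G. h w * \<phi> (v \<otimes> w)))"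
    by (simp add: mult.assoc infsum_cmult_right')
  finally show "(\<Sum>\<^sub>\<infinity>u\<in>carrier G. convolution G g h u * \<phi> u)
       = (\<Sum>\<^sub>\<infinity>v\<in>carrier G. g v * (\<Sum>\<^sub>\<infinity>w\<in>carrier G. h w * \<phi> (v \<otimes> w)))" .
qed

lemma convolution_l1:
  assumes g: "g \<in> l1_space G \<omega>" and h: "h \<in> l1_space G \<omega>"
  shows "convolution G g h \<in> l1_space G \<omega>"
proof -
  \<comment> \<open>The norm series of \<open>g * h\<close> is dominated by that of \<open>\<bar>g\<bar> * \<bar>h\<bar>\<close>, which is the pairing
    of \<open>\<bar>g\<bar> * \<bar>h\<bar>\<close> with \<open>\<omega>\<close>.\<close>
  define g' h' where "g' = (\<lambda>u. complex_of_real (norm (g u)))" and "h' = (\<lambda>u. complex_of_real (norm (h u)))"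
  have g': "g' \<in> l1_space G \<omega>" by (rule l1_domination[OF g]) (auto simp: g'_def l1_vanish[OF g])
  have h': "h' \<in> l1_space G \<omega>" by (rule l1_domination[OF h]) (auto simp: h'_def l1_vanish[OF h])
  have pos: "0 \<le> \<omega> u" if "u \<in> carrier G" for u using weight_ge_1[OF that] by linarith
  have le: "norm (convolution G g h u) \<le> norm (convolution G g' h' u)" if u: "u \<in> carrier G" for u
  proof -
    have hb: "norm (h w) \<le> (\<Sum>\<^sub>\<infinity>w\<in>carrier G. norm (h w))" if "w \<in> carrier G" for w
      using finite_sum_le_infsum[OF l1_abs_summable[OF h], of "{w}"] that by simp
    have s: "(\<lambda>v. g v * h (inv v \<otimes> u)) abs_summable_on carrier G"
    proof (rule Infinite_Sum.abs_summable_on_comparison_test')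
      show "(\<lambda>v. norm (g v) * (\<Sum>\<^sub>\<infinity>w\<in>carrier G. norm (h w))) summable_on carrier G"
        by (intro summable_on_cmult_left l1_abs_summable g)
      show "norm (g v * h (inv v \<otimes> u)) \<le> norm (g v) * (\<Sum>\<^sub>\<infinity>w\<in>carrier G. norm (h w))"
        if "v \<in> carrier G" for v
        using mult_left_mono[OF hb[of "inv v \<otimes> u"] norm_ge_zero[of "g v"]] that u
        by (simp add: norm_mult)
    qed
    have "norm (convolution G g h u) \<le> (\<Sum>\<^sub>\<infinity>v\<in>carrier G. norm (g v * h (inv v \<otimes> u)))"
      using norm_infsum_bound[OF s] u by (simp add: convolution_def)
    also have "\<dots> \<le> norm (complex_of_real \<dots>)" unfolding norm_of_real by (rule abs_ge_self)
    also have "complex_of_real (\<Sum>\<^sub>\<infinity>v\<in>carrier G. norm (g v * h (inv v \<otimes> u))) = convolution G g' h' u"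
    proof -
      have "((\<lambda>v. complex_of_real (norm (g v * h (inv v \<otimes> u)))) has_sum
          complex_of_real (\<Sum>\<^sub>\<infinity>v\<in>carrier G. norm (g v * h (inv v \<otimes> u)))) (carrier G)"
        by (rule has_sum_of_real[OF has_sum_infsum[OF s]])
      from infsumI[OF this] show ?thesis
        using u by (simp add: convolution_def g'_def h'_def norm_mult)
    qed
    finally show ?thesis .
  qed
  have "(\<lambda>u. convolution G g' h' u * complex_of_real (\<omega> u)) summable_on carrier G"
    by (rule convolution_pairing(1)[OF g' h', of _ 1]) (use pos in auto)
  then have "(\<lambda>u. norm (convolution G g' h' u * complex_of_real (\<omega> u))) summable_on carrier G"
    by (rule summable_on_iff_abs_summable_on_complex[THEN iffD1])
  moreover have "(\<lambda>u. norm (convolution G g' h' u * complex_of_real (\<omega> u))) summable_on carrier G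
      \<longleftrightarrow> (\<lambda>u. norm (convolution G g' h' u) * \<omega> u) summable_on carrier G"
    by (rule summable_on_cong) (use pos in \<open>auto simp: norm_mult\<close>)
  ultimately have "convolution G g' h' \<in> l1_space G \<omega>" by (simp add: l1_space_def convolution_def)
  from l1_domination[OF this] show ?thesis using le by (simp add: convolution_def)
qed

text \<open>Right multiplication by \<open>\<delta>\<^sub>y - \<delta>\<^sub>\<one>\<close> takes the difference of a function along the edges
  labelled \<open>y\<close> in the Cayley graph.\<close>

lemma convolution_delta:
  assumes g: "g \<in> l1_space G \<omega>" and y: "y \<in> carrier G" and v: "v \<in> carrier G"
  shows "convolution G g (\<lambda>u. (if u = y then 1 else 0) - (if u = \<one> then 1 else 0)) v
    = g (v \<otimes> inv y) - g v"
proof -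
  have inv_mult: "inv w \<otimes> v = z \<longleftrightarrow> w = v \<otimes> inv z" if "w \<in> carrier G" "z \<in> carrier G" for w z
  proof
    assume "inv w \<otimes> v = z"
    then have "v \<otimes> inv z = v \<otimes> inv (inv w \<otimes> v)" by simp
    also have "\<dots> = w" using that v by (simp add: inv_mult_group m_assoc[symmetric])
    finally show "w = v \<otimes> inv z" by simp
  next
    assume "w = v \<otimes> inv z"
    then show "inv w \<otimes> v = z" using that v by (simp add: inv_mult_group m_assoc)
  qed
  have "inv w \<otimes> v = y \<longleftrightarrow> w = v \<otimes> inv y" "inv w \<otimes> v = \<one> \<longleftrightarrow> w = v" if "w \<in> carrier G" for w
    using inv_mult[OF that y] inv_mult[OF that one_closed] v by simp_all
  then have "convolution G g (\<lambda>u. (if u = y then 1 else 0) - (if u = \<one> then 1 else 0)) v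
     = (\<Sum>\<^sub>\<infinity>w\<in>carrier G. g w * ((if w = v \<otimes> inv y then 1 else 0) - (if w = v then 1 else 0)))"
    using v by (simp add: convolution_def cong: infsum_cong)
  also have "\<dots> = (\<Sum>w\<in>{v \<otimes> inv y, v}. g w * ((if w = v \<otimes> inv y then 1 else 0) - (if w = v then 1 else 0)))"
    by (intro infsumI has_sum_finite_neutralI) (use v y in auto)
  also have "\<dots> = g (v \<otimes> inv y) - g v" by (cases "v \<otimes> inv y = v") auto
  finally show ?thesis .
qed

lemma one_convolution:
  assumes "g \<in> l1_space G \<omega>"
  shows "convolution G (\<lambda>u. if u = \<one> then 1 else 0) g = g"
proof
  fix u
  show "convolution G (\<lambda>u. if u = \<one> then 1 else 0) g u = g u"
  proof (cases "u \<in> carrier G")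
    case True
    then have "((\<lambda>v. (if v = \<one> then 1 else 0) * g (inv v \<otimes> u)) has_sum g u) (carrier G)"
      by (intro has_sum_finite_neutralI[of "{\<one>}"]) auto
    then show ?thesis using True by (simp add: convolution_def infsumI)
  qed (simp add: convolution_def l1_vanish[OF assms])
qed

lemma zero_convolution: "convolution G (\<lambda>u. 0) g = (\<lambda>u. 0)"
  by (auto simp: convolution_def)

lemma abelian_monoid_l1: "abelian_monoid (l1_algebra G \<omega>)"
  by (rule abelian_monoidI) (auto simp: l1_algebra_def l1_zero l1_add add.assoc add.commute)

lemma finsum_l1:
  assumes "finite I" "\<And>i. i \<in> I \<Longrightarrow> F i \<in> l1_space G \<omega>"
  shows "finsum (l1_algebra G \<omega>) F I = (\<lambda>u. \<Sum>i\<in>I. F i u)"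
proof -
  interpret L: abelian_monoid "l1_algebra G \<omega>" by (rule abelian_monoid_l1)
  show ?thesis using assms
  proof (induction I)
    case empty
    show ?case by (simp only: L.finsum_empty) (simp add: l1_algebra_def)
  next
    case (insert i I)
    have "F \<in> I \<rightarrow> carrier (l1_algebra G \<omega>)" "F i \<in> carrier (l1_algebra G \<omega>)"
      using insert.prems by (auto simp: l1_algebra_def)
    then have "finsum (l1_algebra G \<omega>) F (insert i I) = F i \<oplus>\<^bsub>l1_algebra G \<omega>\<^esub> finsum (l1_algebra G \<omega>) F I"
      by (intro L.finsum_insert) (use insert in auto)
    then show ?case using insert by (simp add: l1_algebra_def)
  qed
qed

lemma finitely_generated_left_ideal_l1:
  "finitely_generated_left_ideal (l1_algebra G \<omega>) I \<longleftrightarrow>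
    (\<exists>n h. (\<forall>i<n. h i \<in> l1_space G \<omega>) \<and>
      I = {(\<lambda>u. \<Sum>i<n. convolution G (a i) (h i) u) | a. \<forall>i<n::nat. a i \<in> l1_space G \<omega>})"
proof -
  have car: "carrier (l1_algebra G \<omega>) = l1_space G \<omega>" and mul: "monoid.mult (l1_algebra G \<omega>) = convolution G"
    by (simp_all add: l1_algebra_def)
  have "finsum (l1_algebra G \<omega>) (\<lambda>i. convolution G (a i) (h i)) {..<n}
      = (\<lambda>u. \<Sum>i<n. convolution G (a i) (h i) u)"
    if "\<forall>i<n. h i \<in> l1_space G \<omega>" "\<forall>i<n. a i \<in> l1_space G \<omega>" for n :: nat and a h
    using that by (intro finsum_l1 convolution_l1) auto
  note fs = this
  have eq: "{finsum (l1_algebra G \<omega>) (\<lambda>i. convolution G (a i) (h i)) {..<n} | a. \<forall>i<n. a i \<in> l1_space G \<omega>}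
     = {(\<lambda>u. \<Sum>i<n. convolution G (a i) (h i) u) | a. \<forall>i<n. a i \<in> l1_space G \<omega>}"
    if "\<forall>i<n. h i \<in> l1_space G \<omega>" for n :: nat and h
    by (simp add: fs[OF that] cong: rev_conj_cong)
  have pi: "a \<in> {..<n} \<rightarrow> l1_space G \<omega> \<longleftrightarrow> (\<forall>i<n. a i \<in> l1_space G \<omega>)" for n :: nat and a
    by auto
  show ?thesis unfolding finitely_generated_left_ideal_def car mul pi
    by (simp only: eq cong: conj_cong)
qed

lemma augmentation_ideal_iff:
  "f \<in> augmentation_ideal G \<omega> \<longleftrightarrow> f \<in> l1_space G \<omega> \<and> (\<Sum>\<^sub>\<infinity>u\<in>carrier G. f u) = 0"
  by (simp add: augmentation_ideal_def l1_algebra_def)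

lemma augmentation_ideal_convolution:
  assumes g: "g \<in> l1_space G \<omega>" and h: "h \<in> augmentation_ideal G \<omega>"
  shows "convolution G g h \<in> augmentation_ideal G \<omega>"
  using convolution_pairing(2)[of g h "\<lambda>_. 1" 1] convolution_l1[of g h] g h weight_ge_1
  by (simp add: augmentation_ideal_iff)

lemma augmentation_ideal_sum:
  assumes "finite I" "\<And>i. i \<in> I \<Longrightarrow> F i \<in> augmentation_ideal G \<omega>"
  shows "(\<lambda>u. \<Sum>i\<in>I. F i u) \<in> augmentation_ideal G \<omega>"
  using assms
proof (induction I)
  case empty
  show ?case by (simp add: augmentation_ideal_iff l1_zero)
next
  case (insert i I)
  have sm: "f summable_on carrier G" if "f \<in> augmentation_ideal G \<omega>" for f
    using that l1_abs_summable abs_summable_summable by (auto simp: augmentation_ideal_iff)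
  show ?case using insert infsum_add[OF sm sm, of "F i" "\<lambda>u. \<Sum>i\<in>I. F i u"]
    by (auto simp: augmentation_ideal_iff intro: l1_add)
qed

end

section \<open>Weights of slow growth\<close>

text \<open>The quotient \<open>q n = (\<Sum>j<n. W j) / W n\<close> satisfies \<open>q (n + 1) = (q n + 1) * (W n / W (n + 1))\<close>.
  If \<open>q\<close> were bounded, then the ratios tending to \<open>1\<close> would make it grow by at least \<open>1/2\<close> in
  each late step.\<close>

lemma partial_sums_outgrow:
  fixes W :: "nat \<Rightarrow> real"
  assumes pos: "\<And>n. 0 < W n" and ratio: "(\<lambda>n. W n / W (Suc n)) \<longlonglongrightarrow> 1"
  shows "\<exists>n. s * W n \<le> (\<Sum>j<n. W j)"
proof (rule ccontr)
  assume "\<not> ?thesis"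
  then have small: "(\<Sum>j<n. W j) < s * W n" for n by (simp add: not_le)
  define q where "q n = (\<Sum>j<n. W j) / W n" for n
  have q: "0 \<le> q n" "q n < s" for n
    using small[of n] pos[of n] by (auto simp: q_def divide_simps sum_nonneg less_imp_le[OF pos])
  then have s: "0 < s" by (metis le_less_trans)
  have q_Suc: "q (Suc n) = (q n + 1) * (W n / W (Suc n))" for n
    using pos[of n] by (simp add: q_def add_divide_distrib distrib_right)
  have "0 < 1 / (2 * (s + 1))" using s by simp
  then have "eventually (\<lambda>n. 1 - 1 / (2 * (s + 1)) < W n / W (Suc n)) sequentially"
    using ratio by (intro order_tendstoD(1)) auto
  then obtain N where N: "\<And>n. N \<le> n \<Longrightarrow> 1 - 1 / (2 * (s + 1)) < W n / W (Suc n)"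
    by (auto simp: eventually_sequentially)
  \<comment> \<open>The tolerance \<open>1 / (2 * (s + 1))\<close> loses at most \<open>1/2\<close>, because \<open>q n + 1 \<le> s + 1\<close>.\<close>
  have step: "q n + 1 / 2 \<le> q (Suc n)" if "N \<le> n" for n
  proof -
    have "(q n + 1) * (1 / (2 * (s + 1))) \<le> (s + 1) * (1 / (2 * (s + 1)))"
      using q(2)[of n] s by (intro mult_right_mono) auto
    also have "\<dots> = 1 / 2" using s by (simp add: field_simps)
    finally have "q n + 1 / 2 \<le> (q n + 1) * (1 - 1 / (2 * (s + 1)))"
      by (simp add: right_diff_distrib)
    also have "\<dots> \<le> q (Suc n)"
      unfolding q_Suc using q(1)[of n] less_imp_le[OF N[OF that]] by (intro mult_left_mono) auto
    finally show ?thesis .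
  qed
  have "real k / 2 \<le> q (N + k)" for k
  proof (induction k)
    case (Suc k)
    then show ?case using step[of "N + k"] by (simp add: field_simps)
  qed (simp add: q)
  from this[of "nat \<lceil>2 * s\<rceil>"] show False
    using q(2)[of "N + nat \<lceil>2 * s\<rceil>"] of_nat_ceiling[of "2 * s"] by linarith
qed

text \<open>The truncated first moment \<open>\<Sum> p w * min (k w) (s + 1)\<close> is \<open>o(s)\<close> even if the first moment is
  infinite: a finite set carrying almost all of \<open>p\<close> contributes a bounded amount, and the rest
  contributes at most a small multiple of \<open>s + 1\<close>.\<close>

lemma truncated_moment_small:
  fixes p :: "'c \<Rightarrow> real" and k :: "'c \<Rightarrow> nat"
  assumes p: "p summable_on A" and nonneg: "\<And>w. w \<in> A \<Longrightarrow> 0 \<le> p w" and "0 < \<epsilon>"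
  obtains s :: nat where "1 \<le> s" "(\<Sum>\<^sub>\<infinity>w\<in>A. p w * min (real (k w)) (real s + 1)) \<le> \<epsilon> * real s"
proof -
  obtain F where F: "finite F" "F \<subseteq> A" "dist (sum p F) (infsum p A) \<le> \<epsilon> / 4"
    using infsum_finite_approximation[OF p, of "\<epsilon> / 4"] \<open>0 < \<epsilon>\<close> by auto
  define C where "C = (\<Sum>w\<in>F. p w * real (k w))"
  \<comment> \<open>For such \<open>s\<close> the part on \<open>F\<close>, at most \<open>C\<close>, is below \<open>\<epsilon> * s / 2\<close>; the tail is at most
    \<open>\<epsilon> / 4 * (s + 1)\<close>, hence at most \<open>\<epsilon> * s / 2\<close> as well.\<close>
  obtain s where s: "1 + 2 * C / \<epsilon> \<le> real s" using real_arch_simple by blast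
  have "0 \<le> C" unfolding C_def using F nonneg by (intro sum_nonneg mult_nonneg_nonneg) auto
  then have "0 \<le> C / \<epsilon>" using \<open>0 < \<epsilon>\<close> by simp
  then have s1: "1 \<le> s" using s by linarith
  have Cs: "C \<le> \<epsilon> * real s / 2"
  proof -
    have "2 * C / \<epsilon> \<le> real s" using s by linarith
    then show ?thesis using \<open>0 < \<epsilon>\<close> by (simp add: field_simps)
  qed
  let ?q = "\<lambda>w. p w * min (real (k w)) (real s + 1)"
  have pAF: "p summable_on A - F" using p by (rule summable_on_subset) auto
  have tail_p: "infsum p (A - F) \<le> \<epsilon> / 4"
  proof -
    have "infsum p (F \<union> (A - F)) = sum p F + infsum p (A - F)"
      using infsum_Un_disjoint[OF summable_on_finite[OF F(1)] pAF] F(1) by auto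
    moreover have "F \<union> (A - F) = A" using F(2) by auto
    ultimately show ?thesis using F(3) by (simp add: dist_real_def)
  qed
  have q_le: "?q w \<le> p w * (real s + 1)" "0 \<le> ?q w" "?q w \<le> p w * real (k w)" if "w \<in> A" for w
    using nonneg[OF that] by (auto intro!: mult_left_mono)
  have qAF: "?q summable_on A - F"
    using summable_on_cmult_left[OF pAF, of "real s + 1"] q_le
    by (rule_tac summable_on_comparison_test) auto
  have "infsum ?q (F \<union> (A - F)) = sum ?q F + infsum ?q (A - F)"
    using infsum_Un_disjoint[OF summable_on_finite[OF F(1)] qAF] F(1) by auto
  moreover have "F \<union> (A - F) = A" using F(2) by auto
  moreover have "sum ?q F \<le> C" unfolding C_def using q_le F(2) by (intro sum_mono) auto
  moreover have "infsum ?q (A - F) \<le> infsum p (A - F) * (real s + 1)"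
    unfolding infsum_cmult_left'[symmetric]
    using qAF summable_on_cmult_left[OF pAF, of "real s + 1"] q_le by (intro infsum_mono) auto
  moreover have "infsum p (A - F) * (real s + 1) \<le> \<epsilon> / 4 * (2 * real s)"
    using tail_p s1 \<open>0 < \<epsilon>\<close> by (intro mult_mono) auto
  ultimately have "infsum ?q A \<le> \<epsilon> * real s" using Cs by simp
  with s1 show thesis using that by blast
qed

context weighted_group
begin

text \<open>Since \<open>h\<close> has sum \<open>0\<close>, only the increments of \<open>\<phi>\<close> under right translation matter:
  \<open>\<phi> (g * h) = \<Sum>\<^sub>v g v * (\<Sum>\<^sub>w h w * (\<phi> (v \<otimes> w) - \<phi> v))\<close>. A functional with small increments is
  therefore small on every left multiple of \<open>h\<close>, however large its own norm is.\<close>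

lemma functional_on_left_multiple:
  fixes \<phi> :: "'a \<Rightarrow> complex"
  assumes g: "g \<in> l1_space G \<omega>" and h: "h \<in> augmentation_ideal G \<omega>"
    and \<phi>: "\<And>u. u \<in> carrier G \<Longrightarrow> norm (\<phi> u) \<le> C * \<omega> u"
    and b: "\<And>v w. v \<in> carrier G \<Longrightarrow> w \<in> carrier G \<Longrightarrow> norm (\<phi> (v \<otimes> w) - \<phi> v) \<le> \<omega> v * b w"
    and hb: "(\<lambda>w. norm (h w) * b w) summable_on carrier G"
  shows "norm (\<Sum>\<^sub>\<infinity>u\<in>carrier G. convolution G g h u * \<phi> u)
    \<le> (\<Sum>\<^sub>\<infinity>v\<in>carrier G. norm (g v) * \<omega> v) * (\<Sum>\<^sub>\<infinity>w\<in>carrier G. norm (h w) * b w)"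
proof -
  have h1: "h \<in> l1_space G \<omega>" and h0: "(\<Sum>\<^sub>\<infinity>u\<in>carrier G. h u) = 0"
    using h by (auto simp: augmentation_ideal_iff)
  let ?M = "\<Sum>\<^sub>\<infinity>w\<in>carrier G. norm (h w) * b w"
  let ?D = "\<lambda>v. \<Sum>\<^sub>\<infinity>w\<in>carrier G. h w * \<phi> (v \<otimes> w)"
  have D: "norm (?D v) \<le> \<omega> v * ?M" if v: "v \<in> carrier G" for v
  proof -
    have le: "norm (h w * (\<phi> (v \<otimes> w) - \<phi> v)) \<le> \<omega> v * (norm (h w) * b w)" if "w \<in> carrier G" for w
      using mult_left_mono[OF b[OF v that] norm_ge_zero[of "h w"]] by (simp add: norm_mult ac_simps)
    have sm: "(\<lambda>w. h w * (\<phi> (v \<otimes> w) - \<phi> v)) abs_summable_on carrier G"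
      by (rule Infinite_Sum.abs_summable_on_comparison_test'[OF summable_on_cmult_right[OF hb] le])
    have hs: "h summable_on carrier G" by (rule abs_summable_summable[OF l1_abs_summable[OF h1]])
    have "((\<lambda>w. h w * (\<phi> (v \<otimes> w) - \<phi> v) + h w * \<phi> v) has_sum
        (\<Sum>\<^sub>\<infinity>w\<in>carrier G. h w * (\<phi> (v \<otimes> w) - \<phi> v)) + 0 * \<phi> v) (carrier G)"
      using has_sum_infsum[OF abs_summable_summable[OF sm]] has_sum_cmult_left[OF has_sum_infsum[OF hs]]
      unfolding h0 by (rule has_sum_add)
    then have "?D v = (\<Sum>\<^sub>\<infinity>w\<in>carrier G. h w * (\<phi> (v \<otimes> w) - \<phi> v))"
      by (intro infsumI) (simp add: algebra_simps)
    also have "norm \<dots> \<le> (\<Sum>\<^sub>\<infinity>w\<in>carrier G. norm (h w * (\<phi> (v \<otimes> w) - \<phi> v)))"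
      by (rule norm_infsum_bound[OF sm])
    also have "\<dots> \<le> (\<Sum>\<^sub>\<infinity>w\<in>carrier G. \<omega> v * (norm (h w) * b w))"
      by (rule infsum_mono[OF sm summable_on_cmult_right[OF hb] le])
    finally show ?thesis by (simp add: infsum_cmult_right')
  qed
  have le: "norm (g v * ?D v) \<le> norm (g v) * \<omega> v * ?M" if "v \<in> carrier G" for v
    using mult_left_mono[OF D[OF that] norm_ge_zero[of "g v"]] by (simp add: norm_mult ac_simps)
  have gM: "(\<lambda>v. norm (g v) * \<omega> v * ?M) summable_on carrier G"
    by (intro summable_on_cmult_left l1_summable g)
  have sm: "(\<lambda>v. g v * ?D v) abs_summable_on carrier G"
    by (rule Infinite_Sum.abs_summable_on_comparison_test'[OF gM le])
  have "norm (\<Sum>\<^sub>\<infinity>u\<in>carrier G. convolution G g h u * \<phi> u) = norm (\<Sum>\<^sub>\<infinity>v\<in>carrier G. g v * ?D v)"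
    using convolution_pairing(2)[OF g h1 \<phi>] by simp
  also have "\<dots> \<le> (\<Sum>\<^sub>\<infinity>v\<in>carrier G. norm (g v * ?D v))" by (rule norm_infsum_bound[OF sm])
  also have "\<dots> \<le> (\<Sum>\<^sub>\<infinity>v\<in>carrier G. norm (g v) * \<omega> v * ?M)" by (rule infsum_mono[OF sm gM le])
  finally show ?thesis by (simp add: infsum_cmult_left')
qed

text \<open>One element of the augmentation ideal detects countably many points at once. It is a nonnegative
  function of value at least \<open>(1/2) ^ k / \<omega> (u k)\<close> at \<open>u k\<close>, corrected at the identity to have
  sum \<open>0\<close>. Functionals that are nonnegative and vanish at the identity see no cancellation, so
  this plays the part of the uniform boundedness principle.\<close>

lemma positive_test_element:
  fixes u :: "nat \<Rightarrow> 'a"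
  assumes u: "\<And>k. u k \<in> carrier G"
  shows "\<exists>f\<in>augmentation_ideal G \<omega>. \<forall>\<phi> C k. \<phi> \<one> = 0 \<longrightarrow>
    (\<forall>v\<in>carrier G. 0 \<le> \<phi> v \<and> \<phi> v \<le> C * \<omega> v) \<longrightarrow>
      (1/2) ^ k * (\<phi> (u k) / \<omega> (u k)) \<le> norm (\<Sum>\<^sub>\<infinity>v\<in>carrier G. f v * complex_of_real (\<phi> v))"
proof -
  \<comment> \<open>The \<open>u k\<close> may repeat. Counting a point by its least index keeps the total mass below
    \<open>\<Sum>k. (1/2) ^ k\<close> and only increases the mass assigned to \<open>u k\<close>.\<close>
  define \<kappa> where "\<kappa> v = (LEAST k. u k = v)" for v
  define p where "p v = (if v \<in> range u then (1/2) ^ \<kappa> v / \<omega> v else 0)" for v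
  have pos: "0 < \<omega> v" if "v \<in> carrier G" for v using weight_ge_1[OF that] by linarith
  have u\<kappa>: "u (\<kappa> v) = v" if "v \<in> range u" for v
    using that unfolding \<kappa>_def by (metis (mono_tags) LeastI rangeE)
  have p0: "0 \<le> p v" for v using u less_imp_le[OF pos] by (auto simp: p_def)
  have pu: "(1/2) ^ k / \<omega> (u k) \<le> p (u k)" for k
  proof -
    have "\<kappa> (u k) \<le> k" unfolding \<kappa>_def by (rule Least_le) simp
    then have "(1/2::real) ^ k \<le> (1/2) ^ \<kappa> (u k)" by (intro power_decreasing) auto
    then show ?thesis using pos[OF u, of k] by (auto simp: p_def divide_right_mono)
  qed
  define P where "P v = complex_of_real (p v)" for v
  have nP: "norm (P v) = p v" for v using p0 by (simp add: P_def)
  have P: "P \<in> l1_space G \<omega>"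
  proof -
    have "(\<lambda>n. (1/2::real) ^ n) summable_on UNIV"
      by (rule summable_nonneg_imp_summable_on) (auto intro: summable_geometric)
    then have "(\<lambda>n. (1/2::real) ^ n) summable_on \<kappa> ` range u" by (rule summable_on_subset) auto
    moreover have "inj_on \<kappa> (range u)" using u\<kappa> by (metis inj_on_inverseI)
    ultimately have "(\<lambda>n. (1/2::real) ^ n) \<circ> \<kappa> summable_on range u"
      by (simp add: summable_on_reindex)
    moreover have "(\<lambda>n. (1/2::real) ^ n) \<circ> \<kappa> summable_on range u \<longleftrightarrow>
        (\<lambda>v. norm (P v) * \<omega> v) summable_on carrier G"
    proof (rule summable_on_cong_neutral)
      fix v assume "v \<in> range u \<inter> carrier G"
      then show "((\<lambda>n. (1/2::real) ^ n) \<circ> \<kappa>) v = norm (P v) * \<omega> v"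
        using pos[of v] nP[of v] by (auto simp: p_def)
    qed (use u in \<open>auto simp: P_def p_def\<close>)
    ultimately show ?thesis using u by (auto simp: l1_space_def P_def p_def)
  qed
  have Ps: "P summable_on carrier G" by (rule abs_summable_summable[OF l1_abs_summable[OF P]])
  define \<delta> where "\<delta> v = (if v = \<one> then - infsum P (carrier G) else 0)" for v
  have \<delta>: "\<delta> \<in> l1_space G \<omega>" by (rule l1_finite_support[of "{\<one>}"]) (auto simp: \<delta>_def)
  have "(\<delta> has_sum - infsum P (carrier G)) (carrier G)"
    by (rule has_sum_finite_neutralI[of "{\<one>}"]) (auto simp: \<delta>_def)
  from has_sum_add[OF has_sum_infsum[OF Ps] this]
  have aug: "(\<lambda>v. P v + \<delta> v) \<in> augmentation_ideal G \<omega>"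
    using l1_add[OF P \<delta>] by (simp add: augmentation_ideal_iff infsumI)
  show ?thesis
  proof (intro bexI[OF _ aug] allI impI)
    fix \<phi> :: "'a \<Rightarrow> real" and C k
    assume \<phi>1: "\<phi> \<one> = 0" and "\<forall>v\<in>carrier G. 0 \<le> \<phi> v \<and> \<phi> v \<le> C * \<omega> v"
    then have \<phi>: "0 \<le> \<phi> v \<and> \<phi> v \<le> C * \<omega> v" if "v \<in> carrier G" for v using that by blast
    have "(\<lambda>v. P v * complex_of_real (\<phi> v)) abs_summable_on carrier G"
      by (rule l1_pairing_summable[OF P, of _ C]) (use \<phi> in auto)
    then have "(\<lambda>v. norm (P v * complex_of_real (\<phi> v))) summable_on carrier G" .
    moreover have "(\<lambda>v. norm (P v * complex_of_real (\<phi> v))) summable_on carrier G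
        \<longleftrightarrow> (\<lambda>v. p v * \<phi> v) summable_on carrier G"
      using \<phi> p0 by (intro summable_on_cong) (simp add: P_def norm_mult)
    ultimately have sm: "(\<lambda>v. p v * \<phi> v) summable_on carrier G" by blast
    have "(1/2) ^ k * (\<phi> (u k) / \<omega> (u k)) \<le> p (u k) * \<phi> (u k)"
      using mult_right_mono[OF pu[of k]] \<phi>[OF u, of k] by simp
    also have "\<dots> \<le> (\<Sum>\<^sub>\<infinity>v\<in>carrier G. p v * \<phi> v)"
      using finite_sum_le_infsum[OF sm, of "{u k}"] u p0 \<phi> by simp
    also have "\<dots> \<le> norm (complex_of_real (\<Sum>\<^sub>\<infinity>v\<in>carrier G. p v * \<phi> v))"
      unfolding norm_of_real by (rule abs_ge_self)
    also have "complex_of_real (\<Sum>\<^sub>\<infinity>v\<in>carrier G. p v * \<phi> v)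
        = (\<Sum>\<^sub>\<infinity>v\<in>carrier G. complex_of_real (p v * \<phi> v))"
      by (rule infsumI[OF has_sum_of_real[OF has_sum_infsum[OF sm]], symmetric])
    also have "\<dots> = (\<Sum>\<^sub>\<infinity>v\<in>carrier G. (P v + \<delta> v) * complex_of_real (\<phi> v))"
      by (rule infsum_cong) (auto simp: P_def \<delta>_def \<phi>1)
    finally show "(1/2) ^ k * (\<phi> (u k) / \<omega> (u k))
        \<le> norm (\<Sum>\<^sub>\<infinity>v\<in>carrier G. (P v + \<delta> v) * complex_of_real (\<phi> v))" .
  qed
qed

text \<open>The algebra is unital, so a generator is the combination whose coefficients are \<open>\<delta>\<^sub>\<one>\<close> at its
  own index and \<open>0\<close> elsewhere. In this way the generators inherit the sum \<open>0\<close> from the ideal.\<close>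

lemma generators_in_ideal:
  assumes h: "\<forall>i<n. h i \<in> l1_space G \<omega>"
    and I: "I = {(\<lambda>u. \<Sum>i<n. convolution G (a i) (h i) u) | a. \<forall>i<n::nat. a i \<in> l1_space G \<omega>}"
    and i: "i < n"
  shows "h i \<in> I"
proof -
  define a where "a j = (if j = i then (\<lambda>u. if u = \<one> then 1 else 0) else (\<lambda>u. 0 :: complex))" for j :: nat
  have one: "(\<lambda>u. if u = \<one> then 1 else 0) \<in> l1_space G \<omega>"
    by (rule l1_finite_support[of "{\<one>}"]) auto
  have "convolution G (a j) (h j) u = (if j = i then h i u else 0)" for j u
    using one_convolution[of "h i"] h i by (simp add: a_def zero_convolution)
  then have "(\<lambda>u. \<Sum>j<n. convolution G (a j) (h j) u) = h i" using i by simp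
  then have "\<exists>a. h i = (\<lambda>u. \<Sum>j<n. convolution G (a j) (h j) u) \<and> (\<forall>j<n. a j \<in> l1_space G \<omega>)"
    by (intro exI[of _ a]) (auto simp: a_def one l1_zero)
  then show ?thesis unfolding I by blast
qed

end

locale radially_weighted_group = marked_group G X + weighted_group G \<omega>
  for G (structure) and X \<omega> +
  fixes W :: "nat \<Rightarrow> real"
  assumes finite_gens: "finite X" and radial: "u \<in> carrier G \<Longrightarrow> \<omega> u = W (len u)"
begin

text \<open>The functional is \<open>\<phi> v = \<Phi> (min (len v) n)\<close> with \<open>\<Phi> j = W 0 + \<dots> + W (j - 1)\<close>. One step in the
  Cayley graph changes it by at most the weight, which bounds an increment by \<open>len w\<close> times the
  weights. Choosing \<open>n\<close> as the first level with \<open>\<Phi> n \<ge> s * W n\<close> gives norm at least \<open>s\<close>, and by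
  minimality norm at most \<open>s + 1\<close>, which is the second bound for the increments. Cutting off at
  level \<open>n\<close> extends the norm bound beyond that level.\<close>

lemma steep_test_functional:
  assumes inf: "infinite (carrier G)" and mono: "mono W"
    and ratio: "(\<lambda>n. W n / W (Suc n)) \<longlonglongrightarrow> 1"
  obtains \<phi> :: "'a \<Rightarrow> real" and u where
    "u \<in> carrier G" "\<phi> \<one> = 0" "real s * \<omega> u \<le> \<phi> u"
    "\<And>v. v \<in> carrier G \<Longrightarrow> 0 \<le> \<phi> v \<and> \<phi> v \<le> (real s + 1) * \<omega> v"
    "\<And>v w. v \<in> carrier G \<Longrightarrow> w \<in> carrier G \<Longrightarrow>
      \<bar>\<phi> (v \<otimes> w) - \<phi> v\<bar> \<le> \<omega> v * (\<omega> w * min (real (len w)) (real s + 1))"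
proof -
  \<comment> \<open>Every level is the length of some element, so the values of \<open>W\<close> are weights.\<close>
  have W1: "1 \<le> W n" for n
    using sphere_nonempty[OF finite_gens inf, of n] radial weight_ge_1 by metis
  then have pos: "0 < W n" for n using less_le_trans[OF zero_less_one] by blast
  define \<Phi> where "\<Phi> n = (\<Sum>j<n. W j)" for n
  have \<Phi>_diff: "\<Phi> b - \<Phi> a \<le> real (b - a) * W b" and \<Phi>_mono: "\<Phi> a \<le> \<Phi> b" if "a \<le> b" for a b
  proof -
    have "\<Phi> b - \<Phi> a = (\<Sum>j\<in>{a..<b}. W j)"
      using sum_diff_nat_ivl[of 0 a b W] that by (simp add: \<Phi>_def atLeast0LessThan)
    moreover have "0 \<le> (\<Sum>j\<in>{a..<b}. W j)" by (intro sum_nonneg less_imp_le[OF pos])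
    moreover have "(\<Sum>j\<in>{a..<b}. W j) \<le> real (card {a..<b}) * W b"
      by (rule sum_bounded_above) (auto intro: monoD[OF mono])
    ultimately show "\<Phi> b - \<Phi> a \<le> real (b - a) * W b" "\<Phi> a \<le> \<Phi> b" by auto
  qed
  define n where "n = (LEAST n. real s * W n \<le> \<Phi> n)"
  have n: "real s * W n \<le> \<Phi> n"
    unfolding n_def by (rule LeastI_ex) (use partial_sums_outgrow[OF pos ratio, of "real s"] in \<open>simp add: \<Phi>_def\<close>)
  have below: "\<Phi> j \<le> real s * W j" if "j < n" for j
    using not_less_Least[OF that[unfolded n_def]] by simp
  have upto: "\<Phi> j \<le> (real s + 1) * W j" if "j \<le> n" for j
  proof (cases j)
    case 0
    then show ?thesis using pos[of 0] by (simp add: \<Phi>_def)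
  next
    case (Suc i)
    have "\<Phi> j = \<Phi> i + W i" by (simp add: \<Phi>_def Suc)
    also have "\<dots> \<le> (real s + 1) * W i" using below[of i] Suc that by (simp add: distrib_right)
    also have "\<dots> \<le> (real s + 1) * W j" using monoD[OF mono, of i j] Suc by (intro mult_left_mono) auto
    finally show ?thesis .
  qed
  define \<phi> where "\<phi> v = \<Phi> (min (len v) n)" for v
  have \<phi>: "0 \<le> \<phi> v \<and> \<phi> v \<le> (real s + 1) * \<omega> v" if v: "v \<in> carrier G" for v
  proof -
    have "\<phi> v \<le> (real s + 1) * W (min (len v) n)" unfolding \<phi>_def by (rule upto) simp
    also have "\<dots> \<le> (real s + 1) * W (len v)"
      using monoD[OF mono, of "min (len v) n" "len v"] by (intro mult_left_mono) auto
    finally show ?thesis using \<Phi>_mono[of 0] by (simp add: \<phi>_def radial[OF v] \<Phi>_def sum_nonneg less_imp_le[OF pos])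
  qed
  have lip: "\<bar>\<phi> x - \<phi> v\<bar> \<le> real d * max (\<omega> x) (\<omega> v)"
    if "x \<in> carrier G" "v \<in> carrier G" "len x \<le> len v + d" "len v \<le> len x + d" for x v d
  proof -
    have *: "\<bar>\<phi> x - \<phi> v\<bar> \<le> real d * \<omega> x"
      if "x \<in> carrier G" "len x \<le> len v + d" "len v \<le> len x" for x v
    proof -
      let ?a = "min (len v) n" and ?b = "min (len x) n"
      have ab: "?a \<le> ?b" using that by auto
      have "\<bar>\<phi> x - \<phi> v\<bar> \<le> real (?b - ?a) * W ?b"
        using \<Phi>_diff[OF ab] \<Phi>_mono[OF ab] by (simp add: \<phi>_def)
      also have "\<dots> \<le> real d * W (len x)"
        using that monoD[OF mono, of ?b "len x"] less_imp_le[OF pos] by (intro mult_mono) auto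
      finally show ?thesis using radial that by simp
    qed
    show ?thesis
    proof (cases "len v \<le> len x")
      case True
      have "\<bar>\<phi> x - \<phi> v\<bar> \<le> real d * \<omega> x" using *[of x v] that True by simp
      also have "\<dots> \<le> real d * max (\<omega> x) (\<omega> v)" by (intro mult_left_mono) auto
      finally show ?thesis .
    next
      case False
      have "\<bar>\<phi> v - \<phi> x\<bar> \<le> real d * \<omega> v" using *[of v x] that False by simp
      also have "\<dots> \<le> real d * max (\<omega> x) (\<omega> v)" by (intro mult_left_mono) auto
      finally show ?thesis by (simp add: abs_minus_commute)
    qed
  qed
  have incr: "\<bar>\<phi> (v \<otimes> w) - \<phi> v\<bar> \<le> \<omega> v * (\<omega> w * min (real (len w)) (real s + 1))"
    if v: "v \<in> carrier G" and w: "w \<in> carrier G" for v w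
  proof -
    have vw: "v \<otimes> w \<in> carrier G" using v w by simp
    have max: "max (\<omega> (v \<otimes> w)) (\<omega> v) \<le> \<omega> v * \<omega> w"
      using weight_mult_le[OF v w] mult_left_mono[OF weight_ge_1[OF w], of "\<omega> v"] weight_ge_1[OF v] by simp
    have "\<bar>\<phi> (v \<otimes> w) - \<phi> v\<bar> \<le> real (len w) * max (\<omega> (v \<otimes> w)) (\<omega> v)"
      using lip[OF vw v] len_mult_le[OF v w] len_le_mult[OF v w] by simp
    also have "\<dots> \<le> real (len w) * (\<omega> v * \<omega> w)" using max by (intro mult_left_mono) auto
    finally have 1: "\<bar>\<phi> (v \<otimes> w) - \<phi> v\<bar> \<le> real (len w) * (\<omega> v * \<omega> w)" .
    have "\<bar>\<phi> (v \<otimes> w) - \<phi> v\<bar> \<le> max (\<phi> (v \<otimes> w)) (\<phi> v)" using \<phi>[OF v] \<phi>[OF vw] by auto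
    also have "\<dots> \<le> (real s + 1) * max (\<omega> (v \<otimes> w)) (\<omega> v)"
      using \<phi>[OF v] \<phi>[OF vw] by (simp add: max_mult_distrib_left max.coboundedI1 max.coboundedI2)
    also have "\<dots> \<le> (real s + 1) * (\<omega> v * \<omega> w)" using max by (intro mult_left_mono) auto
    finally have 2: "\<bar>\<phi> (v \<otimes> w) - \<phi> v\<bar> \<le> (real s + 1) * (\<omega> v * \<omega> w)" .
    show ?thesis using 1 2 by (simp add: min_def ac_simps)
  qed
  obtain u where u: "u \<in> carrier G" "len u = n" using sphere_nonempty[OF finite_gens inf] by blast
  show thesis
  proof (rule that[OF u(1)])
    show "\<phi> \<one> = 0" by (simp add: \<phi>_def \<Phi>_def)
    show "real s * \<omega> u \<le> \<phi> u" using n u radial by (simp add: \<phi>_def)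
  qed (use \<phi> incr in auto)
qed

text \<open>Let \<open>h\<^sub>0, \<dots>, h\<^sub>n\<^sub>-\<^sub>1\<close> be generators and \<open>M s\<close> the truncated first moment of \<open>\<Sum>\<^sub>i \<bar>h\<^sub>i\<bar> * \<omega>\<close>.
  At \<open>f = \<Sum>\<^sub>i g\<^sub>i * h\<^sub>i\<close> the test functional for \<open>s\<close> is at most \<open>N * M s\<close>, where \<open>N\<close> is
  the sum of the norms of the \<open>g\<^sub>i\<close>. The levels \<open>s k\<close> are chosen with
  \<open>M (s k) \<le> (1/4) ^ k * s k\<close>, whereas the positive test element makes the functional at least
  \<open>(1/2) ^ k * s k\<close>. Hence \<open>2 ^ k \<le> N\<close> for all \<open>k\<close>.\<close>

theorem augmentation_ideal_not_finitely_generated: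
  assumes inf: "infinite (carrier G)" and mono: "mono W"
    and ratio: "(\<lambda>n. W n / W (Suc n)) \<longlonglongrightarrow> 1"
  shows "\<not> finitely_generated_left_ideal (l1_algebra G \<omega>) (augmentation_ideal G \<omega>)"
proof
  assume "finitely_generated_left_ideal (l1_algebra G \<omega>) (augmentation_ideal G \<omega>)"
  then obtain n h where h: "\<forall>i<n. h i \<in> l1_space G \<omega>"
    and I: "augmentation_ideal G \<omega>
      = {(\<lambda>u. \<Sum>i<n. convolution G (a i) (h i) u) | a. \<forall>i<n::nat. a i \<in> l1_space G \<omega>}"
    unfolding finitely_generated_left_ideal_l1 by blast
  have h_aug: "h i \<in> augmentation_ideal G \<omega>" if "i < n" for i
    by (rule generators_in_ideal[OF h I that])
  have pos: "0 \<le> \<omega> v" if "v \<in> carrier G" for v using weight_ge_1[OF that] by linarith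
  define p where "p w = (\<Sum>i<n. norm (h i w) * \<omega> w)" for w
  have p: "p summable_on carrier G"
    unfolding p_def using h
    by (induction n) (auto intro!: summable_on_add l1_summable)
  have p0: "0 \<le> p w" if "w \<in> carrier G" for w
    unfolding p_def using pos[OF that] by (intro sum_nonneg) auto
  define M where "M s = (\<Sum>\<^sub>\<infinity>w\<in>carrier G. p w * min (real (len w)) (real s + 1))" for s
  have "\<exists>s\<ge>1. M s \<le> (1/4) ^ k * real s" for k
    unfolding M_def by (rule truncated_moment_small[OF p p0, of "(1/4) ^ k" len]) auto
  then obtain s where s: "\<And>k. 1 \<le> s k" "\<And>k. M (s k) \<le> (1/4) ^ k * real (s k)" by metis
  \<comment> \<open>The requirements are named, so that functionals and points for all \<open>k\<close> are chosen at once.\<close>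
  define Q where "Q k \<phi> u \<longleftrightarrow> u \<in> carrier G \<and> \<phi> \<one> = 0 \<and> real (s k) * \<omega> u \<le> \<phi> u \<and>
    (\<forall>v\<in>carrier G. 0 \<le> \<phi> v \<and> \<phi> v \<le> (real (s k) + 1) * \<omega> v) \<and>
    (\<forall>v\<in>carrier G. \<forall>w\<in>carrier G.
      \<bar>\<phi> (v \<otimes> w) - \<phi> v\<bar> \<le> \<omega> v * (\<omega> w * min (real (len w)) (real (s k) + 1)))" for k \<phi> u
  have "\<exists>\<phi> u. Q k \<phi> u" for k
    unfolding Q_def by (rule steep_test_functional[OF assms, of "s k"]) blast
  then obtain \<phi> u where Q: "\<And>k. Q k (\<phi> k) (u k)" by metis
  have u: "u k \<in> carrier G" and \<phi>1: "\<phi> k \<one> = 0"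
    and \<phi>u: "real (s k) * \<omega> (u k) \<le> \<phi> k (u k)" for k
    using Q[of k] unfolding Q_def by blast+
  have \<phi>: "0 \<le> \<phi> k v \<and> \<phi> k v \<le> (real (s k) + 1) * \<omega> v" if "v \<in> carrier G" for k v
    using Q[of k] that unfolding Q_def by blast
  have \<phi>d: "\<bar>\<phi> k (v \<otimes> w) - \<phi> k v\<bar> \<le> \<omega> v * (\<omega> w * min (real (len w)) (real (s k) + 1))"
    if "v \<in> carrier G" "w \<in> carrier G" for k v w
    using Q[of k] that unfolding Q_def by blast
  obtain f where f: "f \<in> augmentation_ideal G \<omega>"
    and f_large: "\<forall>\<phi> C k. \<phi> \<one> = 0 \<longrightarrow> (\<forall>v\<in>carrier G. 0 \<le> \<phi> v \<and> \<phi> v \<le> C * \<omega> v) \<longrightarrow>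
      (1/2) ^ k * (\<phi> (u k) / \<omega> (u k)) \<le> norm (\<Sum>\<^sub>\<infinity>v\<in>carrier G. f v * complex_of_real (\<phi> v))"
    using positive_test_element[of u, OF u] by (elim bexE) (rule that)
  obtain g where g: "\<forall>i<n. g i \<in> l1_space G \<omega>"
    and fg: "f = (\<lambda>u. \<Sum>i<n. convolution G (g i) (h i) u)"
    using f I by blast
  define N where "N = (\<Sum>i<n. \<Sum>\<^sub>\<infinity>v\<in>carrier G. norm (g i v) * \<omega> v)"
  have "2 ^ k \<le> N" for k
  proof -
    let ?\<phi> = "\<lambda>v. complex_of_real (\<phi> k v)"
    let ?b = "\<lambda>w. \<omega> w * min (real (len w)) (real (s k) + 1)"
    have \<phi>C: "norm (?\<phi> v) \<le> (real (s k) + 1) * \<omega> v" if "v \<in> carrier G" for v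
      using \<phi>[OF that, of k] by simp
    have \<phi>b: "norm (?\<phi> (v \<otimes> w) - ?\<phi> v) \<le> \<omega> v * ?b w" if "v \<in> carrier G" "w \<in> carrier G" for v w
      using \<phi>d[OF that, of k] by (simp flip: of_real_diff)
    have "norm (\<Sum>\<^sub>\<infinity>v\<in>carrier G. f v * ?\<phi> v)
        = norm (\<Sum>i<n. \<Sum>\<^sub>\<infinity>v\<in>carrier G. convolution G (g i) (h i) v * ?\<phi> v)"
    proof -
      have "((\<lambda>v. \<Sum>i<m. convolution G (g i) (h i) v * ?\<phi> v) has_sum
          (\<Sum>i<m. \<Sum>\<^sub>\<infinity>v\<in>carrier G. convolution G (g i) (h i) v * ?\<phi> v)) (carrier G)" if "m \<le> n" for m
        using that
      proof (induction m)
        case (Suc m)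
        then show ?case using g h
          by (auto intro!: has_sum_add has_sum_infsum convolution_pairing(1)[OF _ _ \<phi>C])
      qed simp
      from infsumI[OF this[OF order_refl]] show ?thesis by (simp add: fg sum_distrib_right)
    qed
    also have "\<dots> \<le> (\<Sum>i<n. norm (\<Sum>\<^sub>\<infinity>v\<in>carrier G. convolution G (g i) (h i) v * ?\<phi> v))"
      by (rule norm_sum)
    also have "\<dots> \<le> (\<Sum>i<n. (\<Sum>\<^sub>\<infinity>v\<in>carrier G. norm (g i v) * \<omega> v) * M (s k))"
    proof (rule sum_mono)
      fix i assume "i \<in> {..<n}"
      then have i: "i < n" by simp
      have le: "norm (h i w) * ?b w \<le> p w * min (real (len w)) (real (s k) + 1)"
        and nn: "0 \<le> norm (h i w) * ?b w" if w: "w \<in> carrier G" for w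
      proof -
        have "norm (h i w) * \<omega> w \<le> p w"
          unfolding p_def by (rule member_le_sum) (use i pos[OF w] in auto)
        then show "norm (h i w) * ?b w \<le> p w * min (real (len w)) (real (s k) + 1)"
          by (subst mult.assoc[symmetric]) (intro mult_right_mono, auto)
        show "0 \<le> norm (h i w) * ?b w" using pos[OF w] by simp
      qed
      have ps: "(\<lambda>w. p w * min (real (len w)) (real (s k) + 1)) summable_on carrier G"
        by (rule summable_on_comparison_test[OF summable_on_cmult_left[OF p, of "real (s k) + 1"]])
           (use p0 in \<open>auto intro!: mult_left_mono\<close>)
      have hs: "(\<lambda>w. norm (h i w) * ?b w) summable_on carrier G"
        by (rule summable_on_comparison_test[OF ps le nn])
      have "norm (\<Sum>\<^sub>\<infinity>v\<in>carrier G. convolution G (g i) (h i) v * ?\<phi> v)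
          \<le> (\<Sum>\<^sub>\<infinity>v\<in>carrier G. norm (g i v) * \<omega> v) * (\<Sum>\<^sub>\<infinity>w\<in>carrier G. norm (h i w) * ?b w)"
        using g i by (intro functional_on_left_multiple[OF _ h_aug \<phi>C \<phi>b hs]) auto
      also have "\<dots> \<le> (\<Sum>\<^sub>\<infinity>v\<in>carrier G. norm (g i v) * \<omega> v) * M (s k)"
        unfolding M_def
        by (intro mult_left_mono infsum_mono[OF hs ps le] infsum_nonneg) (use pos in auto)
      finally show "norm (\<Sum>\<^sub>\<infinity>v\<in>carrier G. convolution G (g i) (h i) v * ?\<phi> v)
          \<le> (\<Sum>\<^sub>\<infinity>v\<in>carrier G. norm (g i v) * \<omega> v) * M (s k)" .
    qed
    also have "\<dots> = N * M (s k)" by (simp add: N_def sum_distrib_right)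
    also have "\<dots> \<le> N * ((1/4) ^ k * real (s k))"
      unfolding N_def using s(2)[of k] pos
      by (intro mult_left_mono sum_nonneg infsum_nonneg) auto
    finally have upper: "norm (\<Sum>\<^sub>\<infinity>v\<in>carrier G. f v * ?\<phi> v) \<le> N * ((1/4) ^ k * real (s k))" .
    have "(1/2) ^ k * real (s k) \<le> (1/2) ^ k * (\<phi> k (u k) / \<omega> (u k))"
      using \<phi>u[of k] weight_ge_1[OF u, of k] by (intro mult_left_mono) (auto simp: field_simps)
    also have "\<dots> \<le> norm (\<Sum>\<^sub>\<infinity>v\<in>carrier G. f v * ?\<phi> v)"
      by (rule f_large[rule_format, OF \<phi>1 \<phi>])
    finally have "(1/2) ^ k * real (s k) \<le> N * (1/4) ^ k * real (s k)" using upper by simp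
    then have "(1/2) ^ k \<le> N * (1/4) ^ k" using s(1)[of k] by simp
    then have "4 ^ k * (1/2) ^ k \<le> 4 ^ k * (N * (1/4) ^ k)" by (intro mult_left_mono) auto
    then show "2 ^ k \<le> N" by (simp add: power_mult_distrib[symmetric] mult.left_commute)
  qed
  moreover obtain k where "N < 2 ^ k" using real_arch_pow[of 2 N] by auto
  ultimately show False by (meson not_le)
qed

end

section \<open>Weights that dominate their partial sums\<close>

lemma has_sum_diff:
  fixes f g :: "'c \<Rightarrow> complex"
  assumes "(f has_sum a) A" "(g has_sum b) A"
  shows "((\<lambda>x. f x - g x) has_sum a - b) A"
  using has_sum_add[OF assms(1) has_sum_cmult_right[OF assms(2), of "-1"]] by simp

context weighted_group
begin

text \<open>Summing over \<open>v\<close> first bounds the double series of \<open>\<bar>f u\<bar> * \<bar>K u v\<bar> * \<omega> v\<close> by \<open>C\<close> times the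
  norm of \<open>f\<close>; by Fubini the sums over \<open>u\<close> then converge and form an element of the algebra.\<close>

lemma l1_superposition:
  fixes f :: "'a \<Rightarrow> complex" and K :: "'a \<Rightarrow> 'a \<Rightarrow> complex"
  assumes f: "f \<in> l1_space G \<omega>" and K: "\<And>u. u \<in> carrier G \<Longrightarrow> K u \<in> l1_space G \<omega>"
    and bound: "\<And>u. u \<in> carrier G \<Longrightarrow> (\<Sum>\<^sub>\<infinity>v\<in>carrier G. norm (K u v) * \<omega> v) \<le> C * \<omega> u"
  shows "(\<lambda>v. if v \<in> carrier G then \<Sum>\<^sub>\<infinity>u\<in>carrier G. f u * K u v else 0) \<in> l1_space G \<omega>"
    and "v \<in> carrier G \<Longrightarrow> (\<lambda>u. f u * K u v) summable_on carrier G"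
proof -
  have pos: "0 < \<omega> v" if "v \<in> carrier G" for v using weight_ge_1[OF that] by linarith
  let ?\<kappa> = "\<lambda>u. \<Sum>\<^sub>\<infinity>v\<in>carrier G. norm (K u v) * \<omega> v"
  have \<kappa>0: "0 \<le> ?\<kappa> u" for u by (intro infsum_nonneg mult_nonneg_nonneg less_imp_le[OF pos]) auto
  have "(\<lambda>u. norm (f u) * ?\<kappa> u) summable_on carrier G"
  proof (rule summable_on_comparison_test)
    show "(\<lambda>u. norm (f u) * \<omega> u * C) summable_on carrier G"
      by (intro summable_on_cmult_left l1_summable f)
    show "norm (f u) * ?\<kappa> u \<le> norm (f u) * \<omega> u * C" if "u \<in> carrier G" for u
      using mult_left_mono[OF bound[OF that] norm_ge_zero[of "f u"]] by (simp add: ac_simps)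
  qed (simp add: \<kappa>0)
  then have "(\<lambda>(u, v). norm (f u) * (norm (K u v) * \<omega> v)) summable_on carrier G \<times> carrier G"
    by (rule summable_on_SigmaI[rotated])
       (use less_imp_le[OF pos] in \<open>auto intro!: has_sum_cmult_right has_sum_infsum l1_summable K\<close>)
  then have "(\<lambda>(v, u). norm (f u) * (norm (K u v) * \<omega> v)) summable_on carrier G \<times> carrier G"
    by (subst (asm) summable_on_swap) simp
  moreover have "(\<lambda>(v, u). norm (f u) * (norm (K u v) * \<omega> v)) summable_on carrier G \<times> carrier G
      \<longleftrightarrow> (\<lambda>(v, u). norm (f u * K u v) * \<omega> v) summable_on carrier G \<times> carrier G"
    by (rule summable_on_cong) (auto simp: norm_mult ac_simps)
  ultimately have S: "(\<lambda>(v, u). norm (f u * K u v) * \<omega> v) summable_on carrier G \<times> carrier G"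
    by blast
  have row: "(\<lambda>u. f u * K u v) abs_summable_on carrier G" if "v \<in> carrier G" for v
    using summable_on_SigmaD1[OF S that] pos[OF that] by (subst (asm) summable_on_cmult_left') auto
  show "v \<in> carrier G \<Longrightarrow> (\<lambda>u. f u * K u v) summable_on carrier G"
    by (rule abs_summable_summable[OF row])
  let ?g = "\<lambda>v. if v \<in> carrier G then \<Sum>\<^sub>\<infinity>u\<in>carrier G. f u * K u v else 0"
  have "(\<lambda>v. norm (?g v) * \<omega> v) summable_on carrier G"
  proof (rule summable_on_comparison_test[OF summable_on_Sigma_banach[OF S]])
    fix v assume v: "v \<in> carrier G"
    have "norm (?g v) \<le> (\<Sum>\<^sub>\<infinity>u\<in>carrier G. norm (f u * K u v))"
      using norm_infsum_bound[OF row[OF v]] v by simp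
    then show "norm (?g v) * \<omega> v \<le> (\<Sum>\<^sub>\<infinity>u\<in>carrier G. norm (f u * K u v) * \<omega> v)"
      unfolding infsum_cmult_left' using pos[OF v] by (intro mult_right_mono) auto
    show "0 \<le> norm (?g v) * \<omega> v" using pos[OF v] by simp
  qed
  then show "?g \<in> l1_space G \<omega>" by (simp add: l1_space_def)
qed

lemma point_difference_in_augmentation_ideal:
  assumes "y \<in> carrier G"
  shows "(\<lambda>u. (if u = y then 1 else 0) - (if u = \<one> then 1 else 0)) \<in> augmentation_ideal G \<omega>"
proof -
  let ?d = "\<lambda>u. (if u = y then 1 else 0) - (if u = \<one> then 1 else 0) :: complex"
  have "(?d has_sum 0) (carrier G)"
    by (rule has_sum_finite_neutralI[of "{y, \<one>}"]) (use assms in \<open>auto cong: if_cong simp: sum.insert_if\<close>)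
  moreover have "?d \<in> l1_space G \<omega>" by (rule l1_finite_support[of "{y, \<one>}"]) (use assms in auto)
  ultimately show ?thesis by (simp add: augmentation_ideal_iff infsumI)
qed

end

context radially_weighted_group
begin

lemma finite_letters: "finite letters"
  using finite_gens by (simp add: letters_def)

text \<open>The element \<open>\<delta>\<^sub>u - \<delta>\<^sub>\<one>\<close> telescopes along a geodesic from \<open>\<one>\<close> to \<open>u\<close>: \<open>K y\<close> marks
  the vertices that the geodesic leaves along an edge labelled \<open>y\<close>. The geodesic visits each level
  below \<open>n\<close> once, which gives the norm bound.\<close>

lemma path_kernel:
  assumes "u \<in> carrier G" "len u = n"
  shows "\<exists>K. (\<forall>y. K y \<in> l1_space G \<omega>) \<and>
    (\<forall>y. (\<Sum>\<^sub>\<infinity>v\<in>carrier G. norm (K y v) * \<omega> v) \<le> (\<Sum>j<n. W j)) \<and>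
    (\<forall>v\<in>carrier G. (\<Sum>y\<in>letters. K y (v \<otimes> inv y) - K y v)
      = (if v = u then 1 else 0) - (if v = \<one> then 1 else 0 :: complex))"
  using assms
proof (induction n arbitrary: u)
  case 0
  then have "u = \<one>" by (simp add: len_0_iff)
  then show ?case by (intro exI[of _ "\<lambda>_ _. 0"]) (simp add: l1_zero)
next
  case (Suc n)
  obtain u' y0 where u': "u' \<in> carrier G" "len u' = n" and y0: "y0 \<in> letters" and u: "u = u' \<otimes> y0"
    using len_Suc_split[OF Suc.prems] .
  obtain K where K: "\<And>y. K y \<in> l1_space G \<omega>"
    "\<And>y. (\<Sum>\<^sub>\<infinity>v\<in>carrier G. norm (K y v) * \<omega> v) \<le> (\<Sum>j<n. W j)"
    "\<And>v. v \<in> carrier G \<Longrightarrow> (\<Sum>y\<in>letters. K y (v \<otimes> inv y) - K y v)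
      = (if v = u' then 1 else 0) - (if v = \<one> then 1 else 0 :: complex)"
    using Suc.IH[OF u'] by blast
  define e where "e y v = (if y = y0 \<and> v = u' then 1 else 0 :: complex)" for y v
  have e: "e y \<in> l1_space G \<omega>" for y
    by (rule l1_finite_support[of "{u'}"]) (use u' in \<open>auto simp: e_def\<close>)
  have en: "(\<Sum>\<^sub>\<infinity>v\<in>carrier G. norm (e y v) * \<omega> v) \<le> W n" for y
  proof -
    have "(\<Sum>\<^sub>\<infinity>v\<in>carrier G. norm (e y v) * \<omega> v) = norm (e y u') * \<omega> u'"
      by (rule infsumI, rule has_sum_finite_neutralI[of "{u'}"]) (use u' in \<open>auto simp: e_def\<close>)
    also have "\<dots> \<le> W n" using u' radial[OF u'(1)] weight_ge_1[OF u'(1)] by (auto simp: e_def)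
    finally show ?thesis .
  qed
  show ?case
  proof (intro exI[of _ "\<lambda>y v. K y v + e y v"] conjI allI ballI)
    show "(\<lambda>v. K y v + e y v) \<in> l1_space G \<omega>" for y by (rule l1_add[OF K(1) e])
    show "(\<Sum>\<^sub>\<infinity>v\<in>carrier G. norm (K y v + e y v) * \<omega> v) \<le> (\<Sum>j<Suc n. W j)" for y
    proof -
      have "(\<Sum>\<^sub>\<infinity>v\<in>carrier G. norm (K y v + e y v) * \<omega> v)
          \<le> (\<Sum>\<^sub>\<infinity>v\<in>carrier G. norm (K y v) * \<omega> v + norm (e y v) * \<omega> v)"
      proof (rule infsum_mono)
        show "(\<lambda>v. norm (K y v + e y v) * \<omega> v) summable_on carrier G"
          by (rule l1_summable[OF l1_add[OF K(1) e]])
        show "(\<lambda>v. norm (K y v) * \<omega> v + norm (e y v) * \<omega> v) summable_on carrier G"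
          by (intro summable_on_add l1_summable K(1) e)
        show "norm (K y v + e y v) * \<omega> v \<le> norm (K y v) * \<omega> v + norm (e y v) * \<omega> v"
          if "v \<in> carrier G" for v
          using weight_ge_1[OF that] mult_right_mono[OF norm_triangle_ineq[of "K y v" "e y v"], of "\<omega> v"]
          by (simp add: distrib_right)
      qed
      also have "\<dots> = (\<Sum>\<^sub>\<infinity>v\<in>carrier G. norm (K y v) * \<omega> v) + (\<Sum>\<^sub>\<infinity>v\<in>carrier G. norm (e y v) * \<omega> v)"
        by (intro infsum_add l1_summable K(1) e)
      also have "\<dots> \<le> (\<Sum>j<Suc n. W j)" using K(2)[of y] en[of y] by simp
      finally show ?thesis .
    qed
    fix v assume v: "v \<in> carrier G"
    have y0c: "y0 \<in> carrier G" by (rule letters_closed[OF y0])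
    have "v \<otimes> inv y0 = u' \<longleftrightarrow> v = u"
      using v u' y0c unfolding u by (metis inv_solve_right m_closed)
    then have "(\<Sum>y\<in>letters. e y (v \<otimes> inv y) - e y v) = (if v = u then 1 else 0) - (if v = u' then 1 else 0)"
      using y0 finite_letters by (subst sum.remove[of _ y0]) (auto simp: e_def intro!: sum.neutral)
    moreover have "(\<Sum>y\<in>letters. K y (v \<otimes> inv y) + e y (v \<otimes> inv y) - (K y v + e y v))
      = (\<Sum>y\<in>letters. K y (v \<otimes> inv y) - K y v) + (\<Sum>y\<in>letters. e y (v \<otimes> inv y) - e y v)"
      unfolding sum.distrib[symmetric] by (rule sum.cong) auto
    ultimately show "(\<Sum>y\<in>letters. K y (v \<otimes> inv y) + e y (v \<otimes> inv y) - (K y v + e y v))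
      = (if v = u then 1 else 0) - (if v = \<one> then 1 else 0)"
      using K(3)[OF v] by simp
  qed
qed

text \<open>As \<open>f\<close> has sum \<open>0\<close>, it equals \<open>\<Sum>\<^sub>u f u * (\<delta>\<^sub>u - \<delta>\<^sub>\<one>)\<close>. Each \<open>\<delta>\<^sub>u - \<delta>\<^sub>\<one>\<close> is replaced by
  its telescoping sum, and the terms are collected by the letter \<open>y\<close>. The hypothesis says that the
  path from \<open>\<one>\<close> to \<open>u\<close> costs at most a constant times \<open>\<omega> u\<close>, so that the coefficient of
  \<open>\<delta>\<^sub>y - \<delta>\<^sub>\<one>\<close> converges in the algebra.\<close>

theorem augmentation_ideal_finitely_generated:
  assumes bound: "\<And>n. (\<Sum>j<n. W j) \<le> C * W n"
  shows "finitely_generated_left_ideal (l1_algebra G \<omega>) (augmentation_ideal G \<omega>)"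
proof -
  define d where "d y u = (if u = y then 1 else 0) - (if u = \<one> then 1 else 0 :: complex)" for y u
  have d_aug: "d y \<in> augmentation_ideal G \<omega>" if "y \<in> letters" for y
    unfolding d_def by (rule point_difference_in_augmentation_ideal[OF letters_closed[OF that]])
  have d_l1: "d y \<in> l1_space G \<omega>" if "y \<in> letters" for y
    using d_aug[OF that] by (simp add: augmentation_ideal_iff)
  have decompose: "\<exists>g. (\<forall>y. g y \<in> l1_space G \<omega>) \<and> f = (\<lambda>v. \<Sum>y\<in>letters. convolution G (g y) (d y) v)"
    if "f \<in> augmentation_ideal G \<omega>" for f
  proof -
    have f: "f \<in> l1_space G \<omega>" and f0: "(\<Sum>\<^sub>\<infinity>u\<in>carrier G. f u) = 0"
      using that by (auto simp: augmentation_ideal_iff)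
    define Q where "Q u K \<longleftrightarrow> (\<forall>y. K y \<in> l1_space G \<omega>) \<and>
      (\<forall>y. (\<Sum>\<^sub>\<infinity>v\<in>carrier G. norm (K y v) * \<omega> v) \<le> (\<Sum>j<len u. W j)) \<and>
      (\<forall>v\<in>carrier G. (\<Sum>y\<in>letters. K y (v \<otimes> inv y) - K y v) = d u v)" for u K
    have "\<forall>u\<in>carrier G. \<exists>K. Q u K"
      unfolding Q_def d_def using path_kernel[OF _ refl] by blast
    then obtain K where Q: "\<And>u. u \<in> carrier G \<Longrightarrow> Q u (K u)" by metis
    have K_l1: "K u y \<in> l1_space G \<omega>" if "u \<in> carrier G" for u y
      using Q[OF that] unfolding Q_def by blast
    have K_norm: "(\<Sum>\<^sub>\<infinity>v\<in>carrier G. norm (K u y v) * \<omega> v) \<le> C * \<omega> u" if "u \<in> carrier G" for u y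
    proof -
      have "(\<Sum>\<^sub>\<infinity>v\<in>carrier G. norm (K u y v) * \<omega> v) \<le> (\<Sum>j<len u. W j)"
        using Q[OF that] unfolding Q_def by blast
      also have "\<dots> \<le> C * \<omega> u" using bound[of "len u"] radial[OF that] by simp
      finally show ?thesis .
    qed
    have K_d: "(\<Sum>y\<in>letters. K u y (v \<otimes> inv y) - K u y v) = d u v"
      if "u \<in> carrier G" "v \<in> carrier G" for u v
      using Q[OF that(1)] that(2) unfolding Q_def by blast
    define g where "g y v = (if v \<in> carrier G then \<Sum>\<^sub>\<infinity>u\<in>carrier G. f u * K u y v else 0)" for y v
    have g: "g y \<in> l1_space G \<omega>" for y
      unfolding g_def by (rule l1_superposition(1)[OF f K_l1 K_norm])
    have g_sum: "((\<lambda>u. f u * K u y v) has_sum g y v) (carrier G)" if v: "v \<in> carrier G" for y v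
      using has_sum_infsum[OF l1_superposition(2)[OF f K_l1 K_norm v]] v by (simp add: g_def)
    have "f v = (\<Sum>y\<in>letters. convolution G (g y) (d y) v)" for v
    proof (cases "v \<in> carrier G")
      case v: True
      have "((\<lambda>u. \<Sum>y\<in>B. f u * K u y (v \<otimes> inv y) - f u * K u y v) has_sum
          (\<Sum>y\<in>B. g y (v \<otimes> inv y) - g y v)) (carrier G)" if "B \<subseteq> letters" for B
        using finite_subset[OF that finite_letters] that
      proof (induction B)
        case (insert y B)
        then show ?case using v letters_closed[of y]
          by (auto intro!: has_sum_add has_sum_diff g_sum)
      qed simp
      from this[OF order_refl]
      have "((\<lambda>u. f u * (\<Sum>y\<in>letters. K u y (v \<otimes> inv y) - K u y v)) has_sum
          (\<Sum>y\<in>letters. g y (v \<otimes> inv y) - g y v)) (carrier G)"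
        by (simp add: sum_distrib_left right_diff_distrib)
      also have "?this \<longleftrightarrow> ((\<lambda>u. f u * d u v) has_sum (\<Sum>y\<in>letters. g y (v \<otimes> inv y) - g y v)) (carrier G)"
        by (rule has_sum_cong) (simp add: K_d v)
      finally have 1: "((\<lambda>u. f u * d u v) has_sum (\<Sum>y\<in>letters. g y (v \<otimes> inv y) - g y v)) (carrier G)" .
      have "((\<lambda>u. f u * (if v = u then 1 else 0)) has_sum f v) (carrier G)"
        by (rule has_sum_finite_neutralI[of "{v}"]) (use v in auto)
      moreover have "((\<lambda>u. f u * (if v = \<one> then 1 else 0)) has_sum 0 * (if v = \<one> then 1 else 0)) (carrier G)"
        using has_sum_infsum[OF abs_summable_summable[OF l1_abs_summable[OF f]]]
        unfolding f0 by (rule has_sum_cmult_left)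
      ultimately have "((\<lambda>u. f u * d u v) has_sum f v - 0 * (if v = \<one> then 1 else 0)) (carrier G)"
        unfolding d_def right_diff_distrib by (rule has_sum_diff)
      with 1 have "f v = (\<Sum>y\<in>letters. g y (v \<otimes> inv y) - g y v)"
        by (metis has_sum_unique diff_zero mult_zero_left)
      also have "\<dots> = (\<Sum>y\<in>letters. convolution G (g y) (d y) v)"
        unfolding d_def by (intro sum.cong refl) (simp add: convolution_delta g v letters_closed)
      finally show ?thesis .
    next
      case False
      then show ?thesis by (simp add: convolution_def l1_vanish[OF f])
    qed
    then show ?thesis using g by blast
  qed
  obtain e where e: "bij_betw e {..<card letters} letters"
    using ex_bij_betw_nat_finite[OF finite_letters] by (auto simp: atLeast0LessThan)
  then have e_mem: "e i \<in> letters" if "i < card letters" for i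
    using that by (auto simp: bij_betw_def)
  have "augmentation_ideal G \<omega> = {(\<lambda>u. \<Sum>i<card letters. convolution G (a i) (d (e i)) u) | a.
      \<forall>i<card letters. a i \<in> l1_space G \<omega>}" (is "_ = ?R")
  proof (intro equalityI subsetI)
    fix f assume "f \<in> augmentation_ideal G \<omega>"
    then obtain g where g: "\<And>y. g y \<in> l1_space G \<omega>"
      "f = (\<lambda>v. \<Sum>y\<in>letters. convolution G (g y) (d y) v)" using decompose by blast
    then have "f = (\<lambda>v. \<Sum>i<card letters. convolution G (g (e i)) (d (e i)) v)"
      using sum.reindex_bij_betw[OF e, of "\<lambda>y. convolution G (g y) (d y) v" for v] by simp
    then show "f \<in> ?R" using g(1) by (intro CollectI exI[of _ "\<lambda>i. g (e i)"]) simp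
  next
    fix f assume "f \<in> ?R"
    then show "f \<in> augmentation_ideal G \<omega>"
      using e_mem by (auto intro!: augmentation_ideal_sum augmentation_ideal_convolution d_aug)
  qed
  then show ?thesis unfolding finitely_generated_left_ideal_l1
    using e_mem d_l1 by (intro exI[of _ "card letters"] exI[of _ "\<lambda>i. d (e i)"]) simp
qed

end

section \<open>Radial polynomial and exponential weights\<close>

lemma polynomial_growth_ratio: "(\<lambda>n. (1 + real n) powr \<alpha> / (1 + real (Suc n)) powr \<alpha>) \<longlonglongrightarrow> 1"
proof -
  have "(\<lambda>n. (1 + real n) / (1 + real (Suc n))) \<longlonglongrightarrow> 1" by real_asymp
  then have "(\<lambda>n. ((1 + real n) / (1 + real (Suc n))) powr \<alpha>) \<longlonglongrightarrow> 1 powr \<alpha>"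
    by (intro tendsto_powr tendsto_const) auto
  then show ?thesis by (simp add: powr_divide)
qed

lemma subexponential_growth_ratio:
  fixes c \<beta> :: real
  assumes "0 < c" "0 < \<beta>" "\<beta> < 1"
  shows "(\<lambda>n. c powr (real n powr \<beta>) / c powr (real (Suc n) powr \<beta>)) \<longlonglongrightarrow> 1"
proof -
  have "(\<lambda>n. real n powr \<beta> - real (Suc n) powr \<beta>) \<longlonglongrightarrow> 0" using assms by real_asymp
  then have "(\<lambda>n. c powr (real n powr \<beta> - real (Suc n) powr \<beta>)) \<longlonglongrightarrow> c powr 0"
    using assms by (intro tendsto_powr tendsto_const) auto
  then show ?thesis using assms by (simp add: powr_diff)
qed

lemma geometric_sum_le:
  fixes c :: real
  assumes "1 < c"
  shows "(\<Sum>j<n. c ^ j) \<le> 1 / (c - 1) * c ^ n"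
proof -
  have "(\<Sum>j<n. c ^ j) = (c ^ n - 1) / (c - 1)" by (rule geometric_sum) (use assms in simp)
  also have "\<dots> \<le> c ^ n / (c - 1)" using assms by (intro divide_right_mono) auto
  finally show ?thesis by simp
qed

theorem corollary1p9:
  fixes G :: "('a, 'b) monoid_scheme" and X :: "'a set" and \<omega> :: "'a \<Rightarrow> real"
  assumes "group G"
    and "finite X" and "X \<subseteq> carrier G" and "generate G X = carrier G"
    and "weight G \<omega>"
  shows "((\<exists>\<alpha>. radial_polynomial_weight G X \<alpha> \<omega>) \<or>
          (\<exists>c \<beta>. \<beta> < 1 \<and> radial_exponential_weight G X c \<beta> \<omega>)
            \<longrightarrow> finitely_generated_left_ideal (l1_algebra G \<omega>) (augmentation_ideal G \<omega>)
            \<longrightarrow> finite (carrier G)) \<and>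
         ((\<exists>c>1. radial_exponential_weight G X c 1 \<omega>)
            \<longrightarrow> finitely_generated_left_ideal (l1_algebra G \<omega>) (augmentation_ideal G \<omega>))"
proof -
  interpret marked_group G X
    using assms by (intro marked_group.intro) (auto simp: marked_group_axioms_def)
  interpret weighted_group G \<omega>
    using assms by (intro weighted_group.intro) (auto simp: weighted_group_axioms_def)
  have radially_weighted: "radially_weighted_group G X \<omega> W"
    if "\<And>u. u \<in> carrier G \<Longrightarrow> \<omega> u = W (len u)" for W
    using assms(2) that by unfold_locales auto
  have finite_if_finitely_generated: "finite (carrier G)"
    if fg: "finitely_generated_left_ideal (l1_algebra G \<omega>) (augmentation_ideal G \<omega>)"
      and "\<And>u. u \<in> carrier G \<Longrightarrow> \<omega> u = W (len u)" and "mono W"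
      and "(\<lambda>n. W n / W (Suc n)) \<longlonglongrightarrow> 1" for W
    using radially_weighted_group.augmentation_ideal_not_finitely_generated[OF radially_weighted[of W]] that
    by blast
  show ?thesis
  proof (intro conjI impI)
    assume fg: "finitely_generated_left_ideal (l1_algebra G \<omega>) (augmentation_ideal G \<omega>)"
    assume "(\<exists>\<alpha>. radial_polynomial_weight G X \<alpha> \<omega>) \<or>
          (\<exists>c \<beta>. \<beta> < 1 \<and> radial_exponential_weight G X c \<beta> \<omega>)"
    then show "finite (carrier G)"
    proof (elim disjE exE conjE)
      fix \<alpha> assume w: "radial_polynomial_weight G X \<alpha> \<omega>"
      show ?thesis
      proof (rule finite_if_finitely_generated[OF fg])
        show "\<omega> u = (1 + real (len u)) powr \<alpha>" if "u \<in> carrier G" for u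
          using w that by (simp add: radial_polynomial_weight_def)
        show "mono (\<lambda>n. (1 + real n) powr \<alpha>)"
          using w by (intro monoI powr_mono2) (auto simp: radial_polynomial_weight_def)
      qed (rule polynomial_growth_ratio)
    next
      fix c \<beta> :: real assume \<beta>: "\<beta> < 1" and w: "radial_exponential_weight G X c \<beta> \<omega>"
      show ?thesis
      proof (rule finite_if_finitely_generated[OF fg])
        show "\<omega> u = c powr (real (len u) powr \<beta>)" if "u \<in> carrier G" for u
          using w that by (simp add: radial_exponential_weight_def)
        show "mono (\<lambda>n. c powr (real n powr \<beta>))"
          using w by (intro monoI powr_mono powr_mono2) (auto simp: radial_exponential_weight_def)
        show "(\<lambda>n. c powr (real n powr \<beta>) / c powr (real (Suc n) powr \<beta>)) \<longlonglongrightarrow> 1"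
          using w \<beta> by (intro subexponential_growth_ratio) (auto simp: radial_exponential_weight_def)
      qed
    qed
  next
    assume "\<exists>c>1. radial_exponential_weight G X c 1 \<omega>"
    then obtain c where c: "1 < c" and w: "radial_exponential_weight G X c 1 \<omega>" by blast
    have "\<omega> u = c ^ len u" if "u \<in> carrier G" for u
      using w c that by (simp add: radial_exponential_weight_def powr_realpow)
    from radially_weighted_group.augmentation_ideal_finitely_generated[OF radially_weighted[OF this] geometric_sum_le[OF c]]
    show "finitely_generated_left_ideal (l1_algebra G \<omega>) (augmentation_ideal G \<omega>)" .
  qed
qed

end
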